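(* Let $N \in \mathcal{Z}$ be a separable polynomial. (i) There exists an isomorphism of $K$-algebras $\tau_N : \hat{\mathcal{A}}_N \to (\mathcal{A}/N\mathcal{A})[[T]]$ mapping $N$ to $T$ and inducing the identity of $\mathcal{A}/N\mathcal{A}$ after quotienting out by $N$ on the left (source) and by $T$ on the right (target). (ii) Every isomorphism of $K$-algebras $\tau_N$ satisfying the conditions of (i) is compatible with $\tau_N^{\mathcal{C}}$, i.e. the restriction of $\tau_N$ to $\hat{\mathcal{C}}_N \subset \hat{\mathcal{A}}_N$ takes values in $(\mathcal{C}/N\mathcal{C})[[T]] \subset (\mathcal{A}/N\mathcal{A})[[T]]$ and equals $\tau_N^{\mathcal{C}}$.
   Context: Let $K$ be a field with an automorphism $\theta$ of finite order $r$, and $F = \{a\in K : \theta(a)=a\}$. Let $\mathcal{A} = K[X^{\pm 1};\theta]$ be the ring of skew Laurent polynomials, with multiplication determined by $Xa = \theta(a)X$ for $a\in K$. Put $Y = X^r$, $\mathcal{C} = K[Y^{\pm1}]$ (a commutative subring) and $\mathcal{Z} = F[Y^{\pm 1}]$ (the centre of $\mathcal{A}$). A "$K$-algebra" is a possibly noncommutative ring $B$ with a ring homomorphism $K \to B$ (the image of $K$ need not be central); morphisms of $K$-algebras are ring homomorphisms compatible with these maps. A polynomial $N\in\mathcal{Z}$ is separable if $N$ and $\frac{dN}{dY}$ generate the unit ideal of $\mathcal{Z}$. Set $\hat{\mathcal{A}}_N = \varprojlim_{m\ge 1} \mathcal{A}/N^m\mathcal{A}$ and $\hat{\mathcal{C}}_N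 = \varprojlim_{m\ge 1} \mathcal{C}/N^m\mathcal{C}$. In $(\mathcal{A}/N\mathcal{A})[[T]]$ the variable $T$ is central. For $N$ separable, $\tau_N^{\mathcal{C}} : \hat{\mathcal{C}}_N \to (\mathcal{C}/N\mathcal{C})[[T]]$ denotes the unique isomorphism of $K$-algebras mapping $N$ to $T$ and inducing the identity $\mathcal{C}/N\mathcal{C}\to\mathcal{C}/N\mathcal{C}$ after reduction modulo $N$ on the source and modulo $T$ on the target. *)

theory Defs
  imports "HOL-Algebra.QuotRing" "HOL-Library.Poly_Mapping"
begin

definition field_automorphism :: "('k::field \<Rightarrow> 'k) \<Rightarrow> bool" where
  "field_automorphism \<theta> \<longleftrightarrow>
     bij \<theta> \<and> \<theta> 1 = 1 \<and> (\<forall>a b. \<theta> (a + b) = \<theta> a + \<theta> b) \<and> (\<forall>a b. \<theta> (a * b) = \<theta> a * \<theta> b)"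

definition has_order :: "('a \<Rightarrow> 'a) \<Rightarrow> nat \<Rightarrow> bool" where
  "has_order \<theta> r \<longleftrightarrow> 0 < r \<and> \<theta> ^^ r = id \<and> (\<forall>s. 0 < s \<and> s < r \<longrightarrow> \<theta> ^^ s \<noteq> id)"

definition int_funpow :: "('a \<Rightarrow> 'a) \<Rightarrow> int \<Rightarrow> 'a \<Rightarrow> 'a" where
  "int_funpow \<theta> i = (if 0 \<le> i then \<theta> ^^ nat i else inv_into UNIV \<theta> ^^ nat (- i))"


subsection \<open>Skew Laurent polynomials\<close>

text \<open>
  A finitely supported function \<open>f\<close> stands for the Laurent polynomial
  \<open>\<Sum>i. lookup f i X\<^sup>i\<close>, with coefficients on the left of the powers of \<open>X\<close>. The relation
  \<open>X a = \<theta>(a) X\<close> amounts to \<open>(a X\<^sup>i) (b X\<^sup>j) = a \<theta>\<^sup>i(b) X\<^sup>i\<^sup>+\<^sup>j\<close>.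
\<close>

definition skew_laurent :: "('k::field \<Rightarrow> 'k) \<Rightarrow> (int \<Rightarrow>\<^sub>0 'k) ring" where
  "skew_laurent \<theta> =
    \<lparr>carrier = UNIV,
     mult = (\<lambda>f g. \<Sum>i\<in>Poly_Mapping.keys f. \<Sum>j\<in>Poly_Mapping.keys g.
               Poly_Mapping.single (i + j)
                 (Poly_Mapping.lookup f i * int_funpow \<theta> i (Poly_Mapping.lookup g j))),
     one = Poly_Mapping.single 0 1,
     zero = 0,
     add = (+)\<rparr>"

definition laurent_const :: "'k::field \<Rightarrow> int \<Rightarrow>\<^sub>0 'k" where
  "laurent_const a = Poly_Mapping.single 0 a"

text \<open>
  The subrings \<open>K[Y\<^sup>\<plusminus>\<^sup>1]\<close> and \<open>F[Y\<^sup>\<plusminus>\<^sup>1]\<close>, where \<open>Y = X\<^sup>r\<close> and \<open>F\<close> is the fixed field of \<open>\<theta>\<close>.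
\<close>

definition laurent_C :: "('k::field \<Rightarrow> 'k) \<Rightarrow> nat \<Rightarrow> (int \<Rightarrow>\<^sub>0 'k) ring" where
  "laurent_C \<theta> r = (skew_laurent \<theta>)\<lparr>carrier := {f. \<forall>i\<in>Poly_Mapping.keys f. int r dvd i}\<rparr>"

definition laurent_Z :: "('k::field \<Rightarrow> 'k) \<Rightarrow> nat \<Rightarrow> (int \<Rightarrow>\<^sub>0 'k) ring" where
  "laurent_Z \<theta> r = (skew_laurent \<theta>)\<lparr>carrier :=
     {f. (\<forall>i\<in>Poly_Mapping.keys f. int r dvd i) \<and>
         (\<forall>i. \<theta> (Poly_Mapping.lookup f i) = Poly_Mapping.lookup f i)}\<rparr>"

text \<open>The derivative with respect to \<open>Y\<close>: the exponent \<open>i\<close> of \<open>X\<close> is the exponent \<open>i / r\<close> of \<open>Y\<close>.\<close>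

definition deriv_Y :: "nat \<Rightarrow> (int \<Rightarrow>\<^sub>0 'k::field) \<Rightarrow> (int \<Rightarrow>\<^sub>0 'k)" where
  "deriv_Y r f =
     (\<Sum>i\<in>Poly_Mapping.keys f. Poly_Mapping.single (i - int r)
        (of_int (i div int r) * Poly_Mapping.lookup f i))"

definition separable_Z :: "('k::field \<Rightarrow> 'k) \<Rightarrow> nat \<Rightarrow> (int \<Rightarrow>\<^sub>0 'k) \<Rightarrow> bool" where
  "separable_Z \<theta> r N \<longleftrightarrow>
     Idl\<^bsub>laurent_Z \<theta> r\<^esub> {N, deriv_Y r N} = carrier (laurent_Z \<theta> r)"


subsection \<open>Completions and power series\<close>

text \<open>
  The right multiples \<open>a R\<close>; below \<open>a\<close> is a power of a central element, so this is a
  two-sided ideal.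
\<close>

definition multiples :: "('a, 'm) ring_scheme \<Rightarrow> 'a \<Rightarrow> 'a set" where
  "multiples R a = {a \<otimes>\<^bsub>R\<^esub> x |x. x \<in> carrier R}"

definition level :: "('a, 'm) ring_scheme \<Rightarrow> 'a \<Rightarrow> nat \<Rightarrow> 'a set ring" where
  "level R N m = R Quot multiples R (N [^]\<^bsub>R\<^esub> m)"

text \<open>
  The inverse limit of the rings \<open>R / N\<^sup>m R\<close> over \<open>m \<ge> 1\<close>: families of cosets \<open>x m\<close> such that
  the canonical projection from level \<open>n\<close> to level \<open>m \<le> n\<close> sends \<open>x n\<close> to \<open>x m\<close>.
\<close>

definition adic_completion :: "('a, 'm) ring_scheme \<Rightarrow> 'a \<Rightarrow> (nat \<Rightarrow> 'a set) ring" where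
  "adic_completion R N =
    \<lparr>carrier = {x \<in> (\<Pi>\<^sub>E m\<in>{1..}. carrier (level R N m)).
       \<forall>m n. 1 \<le> m \<and> m \<le> n \<longrightarrow> (\<exists>a\<in>carrier R.
          x n = multiples R (N [^]\<^bsub>R\<^esub> n) +>\<^bsub>R\<^esub> a \<and> x m = multiples R (N [^]\<^bsub>R\<^esub> m) +>\<^bsub>R\<^esub> a)},
     mult = (\<lambda>x y. \<lambda>m\<in>{1..}. x m \<otimes>\<^bsub>level R N m\<^esub> y m),
     one = (\<lambda>m\<in>{1..}. \<one>\<^bsub>level R N m\<^esub>),
     zero = (\<lambda>m\<in>{1..}. \<zero>\<^bsub>level R N m\<^esub>),
     add = (\<lambda>x y. \<lambda>m\<in>{1..}. x m \<oplus>\<^bsub>level R N m\<^esub> y m)\<rparr>"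

definition to_completion :: "('a, 'm) ring_scheme \<Rightarrow> 'a \<Rightarrow> 'a \<Rightarrow> nat \<Rightarrow> 'a set" where
  "to_completion R N a = (\<lambda>m\<in>{1..}. multiples R (N [^]\<^bsub>R\<^esub> m) +>\<^bsub>R\<^esub> a)"

text \<open>Power series \<open>\<Sum>n. f n T\<^sup>n\<close> in a central variable over a possibly noncommutative ring.\<close>

definition power_series_ring :: "('b, 'm) ring_scheme \<Rightarrow> (nat \<Rightarrow> 'b) ring" where
  "power_series_ring R =
    \<lparr>carrier = {f. \<forall>n. f n \<in> carrier R},
     mult = (\<lambda>f g n. \<Oplus>\<^bsub>R\<^esub>i\<in>{..n}. f i \<otimes>\<^bsub>R\<^esub> g (n - i)),
     one = (\<lambda>n. if n = 0 then \<one>\<^bsub>R\<^esub> else \<zero>\<^bsub>R\<^esub>),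
     zero = (\<lambda>n. \<zero>\<^bsub>R\<^esub>),
     add = (\<lambda>f g n. f n \<oplus>\<^bsub>R\<^esub> g n)\<rparr>"

definition series_const :: "('b, 'm) ring_scheme \<Rightarrow> 'b \<Rightarrow> nat \<Rightarrow> 'b" where
  "series_const R b = (\<lambda>n. if n = 0 then b else \<zero>\<^bsub>R\<^esub>)"

definition series_T :: "('b, 'm) ring_scheme \<Rightarrow> nat \<Rightarrow> 'b" where
  "series_T R = (\<lambda>n. if n = 1 then \<one>\<^bsub>R\<^esub> else \<zero>\<^bsub>R\<^esub>)"

definition quot_series :: "('a, 'm) ring_scheme \<Rightarrow> 'a \<Rightarrow> (nat \<Rightarrow> 'a set) ring" where
  "quot_series R N = power_series_ring (R Quot multiples R N)"


subsection \<open>The isomorphisms\<close>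

text \<open>
  Isomorphisms of \<open>K\<close>-algebras; an algebra is a ring together with its structure map
  \<open>\<eta>\<close> from \<open>K\<close>, whose image need not be central.
\<close>

definition alg_iso ::
  "('a, 'm) ring_scheme \<Rightarrow> ('k \<Rightarrow> 'a) \<Rightarrow> ('b, 'n) ring_scheme \<Rightarrow> ('k \<Rightarrow> 'b) \<Rightarrow> ('a \<Rightarrow> 'b) set" where
  "alg_iso B \<eta> B' \<eta>' = {h \<in> ring_iso B B'. \<forall>a. h (\<eta> a) = \<eta>' a}"

text \<open>
  Here \<open>R\<close> is \<open>skew_laurent \<theta>\<close> or \<open>laurent_C \<theta> r\<close>. In the last clause the quotient by \<open>N\<close> on
  the source is the projection to the component \<open>m = 1\<close>, and the quotient by \<open>T\<close> on the
  target is the constant coefficient.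
\<close>

definition is_tau ::
  "(int \<Rightarrow>\<^sub>0 'k::field) ring \<Rightarrow> (int \<Rightarrow>\<^sub>0 'k) \<Rightarrow>
   ((nat \<Rightarrow> (int \<Rightarrow>\<^sub>0 'k) set) \<Rightarrow> (nat \<Rightarrow> (int \<Rightarrow>\<^sub>0 'k) set)) \<Rightarrow> bool" where
  "is_tau R N \<tau> \<longleftrightarrow>
     \<tau> \<in> alg_iso
           (adic_completion R N) (\<lambda>a. to_completion R N (laurent_const a))
           (quot_series R N)
           (\<lambda>a. series_const (R Quot multiples R N) (multiples R N +>\<^bsub>R\<^esub> laurent_const a)) \<and>
     \<tau> (to_completion R N N) = series_T (R Quot multiples R N) \<and>
     (\<forall>x\<in>carrier (adic_completion R N). \<tau> x 0 = x 1)"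

text \<open>
  Uniqueness only makes sense for maps on the completion, hence the normalisation by
  \<^const>\<open>extensional\<close>.
\<close>

definition tau_C ::
  "('k::field \<Rightarrow> 'k) \<Rightarrow> nat \<Rightarrow> (int \<Rightarrow>\<^sub>0 'k) \<Rightarrow>
   (nat \<Rightarrow> (int \<Rightarrow>\<^sub>0 'k) set) \<Rightarrow> (nat \<Rightarrow> (int \<Rightarrow>\<^sub>0 'k) set)" where
  "tau_C \<theta> r N = (THE \<sigma>. \<sigma> \<in> extensional (carrier (adic_completion (laurent_C \<theta> r) N)) \<and>
                          is_tau (laurent_C \<theta> r) N \<sigma>)"

text \<open>
  The inclusions induced by \<open>laurent_C \<theta> r \<subseteq> skew_laurent \<theta>\<close>: a coset \<open>c + N\<^sup>m C\<close> is sent to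
  \<open>c + N\<^sup>m A\<close>, obtained as the sum of sets \<open>N\<^sup>m A + (c + N\<^sup>m C)\<close>.
\<close>

definition completion_incl ::
  "('a, 'm) ring_scheme \<Rightarrow> 'a \<Rightarrow> (nat \<Rightarrow> 'a set) \<Rightarrow> (nat \<Rightarrow> 'a set)" where
  "completion_incl A N x = (\<lambda>m\<in>{1..}. multiples A (N [^]\<^bsub>A\<^esub> m) <+>\<^bsub>A\<^esub> x m)"

definition series_incl ::
  "('a, 'm) ring_scheme \<Rightarrow> 'a \<Rightarrow> (nat \<Rightarrow> 'a set) \<Rightarrow> (nat \<Rightarrow> 'a set)" where
  "series_incl A N f = (\<lambda>n. multiples A N <+>\<^bsub>A\<^esub> f n)"

end

theory Submission
  imports Defs "HOL-Algebra.UnivPoly" "HOL-Computational_Algebra.Formal_Power_Series"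
begin

text \<open>
  Existence. Choose \<open>b \<in> K\<close> of trace 1, by independence of the powers of \<open>\<theta>\<close>. The rule
  \<open>X \<mapsto> (1 + b T) X\<close> extends to a \<open>K\<close>-algebra homomorphism from \<open>\<A>\<close> to \<open>\<A>[[T]]\<close>, with
  \<open>Y \<mapsto> (1 + T + \<dots>) Y\<close>; hence \<open>N \<mapsto> N + T h\<close> with \<open>h\<close> central and constant term
  \<open>Y dN/dY\<close>, a unit modulo \<open>N\<close>. Modulo \<open>N\<close>, \<open>T h\<close> is another uniformizer, and taking coefficients
  of expansions in powers of \<open>T h\<close> yields a homomorphism to \<open>(\<A>/N\<A>)[[T]]\<close> sending \<open>N\<close> to \<open>T\<close>. Any
  homomorphism with this property that lifts the projection extends to an isomorphism from the
  completion. The same construction works for \<open>\<C>\<close>.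

  Compatibility and uniqueness. If two such homomorphisms from \<open>\<C>\<close> to \<open>(\<A>/N\<A>)[[T]]\<close> first
  differ in degree \<open>n\<close>, the difference of their \<open>n\<close>-th coefficients is a \<open>K\<close>-derivation \<open>\<delta>\<close>. As
  \<open>Y\<close> is central, \<open>\<delta>(f) = (df/dY) \<delta>(Y)\<close>, and \<open>\<delta>(N) = 0\<close> with \<open>dN/dY\<close> invertible gives
  \<open>\<delta> = 0\<close>.
\<close>

text \<open>With X \<mapsto> (1 + T) X the first-order term of the image of N would be r Y dN/dY,
  which vanishes when the characteristic divides r. An element b of trace 1 turns this factor r into
  1 in every characteristic. Modulo N the image of N is T h and not T. Re-expanding in powers of T h
  repairs this without solving an equation: the digits are given by an explicit recursion in A[[T]]
  and are reduced modulo N only at the end. The type of finitely supported functions already carries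
  a commutative product \<open>*\<close>, that of ordinary Laurent polynomials. It agrees with the
  skew product when the left factor lies in C or one of the factors lies in Z, so power series with
  coefficients in Z can be treated as commutative \<open>fps\<close> acting on A[[T]]. A and C are
  the cases d = 1 and d = r of \<open>laurent_C \<theta> d\<close>; existence is proved once for
  every d dividing r.\<close>

section \<open>Ideals generated by a central element; multiplication by T\<close>

lemma multiplesI: "x \<in> carrier R \<Longrightarrow> a = c \<otimes>\<^bsub>R\<^esub> x \<Longrightarrow> a \<in> multiples R c"
  by (auto simp: multiples_def)

lemma multiplesE:
  assumes "a \<in> multiples R c"
  obtains x where "x \<in> carrier R" "a = c \<otimes>\<^bsub>R\<^esub> x"
  using assms by (auto simp: multiples_def)

lemma (in ring) ideal_multiples:
  assumes c: "c \<in> carrier R" and central: "\<And>x. x \<in> carrier R \<Longrightarrow> c \<otimes> x = x \<otimes> c"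
  shows "ideal (multiples R c) R"
proof (rule idealI)
  show "ring R" by (rule ring_axioms)
  show "subgroup (multiples R c) (add_monoid R)"
  proof (rule add.subgroupI)
    show "multiples R c \<subseteq> carrier R" using c by (auto simp: multiples_def)
    show "multiples R c \<noteq> {}" by (auto simp: multiples_def)
    fix a assume "a \<in> multiples R c"
    then obtain x where x: "x \<in> carrier R" "a = c \<otimes> x" by (auto simp: multiples_def)
    then have "\<ominus> a = c \<otimes> (\<ominus> x)" using c by (simp add: r_minus)
    then show "\<ominus> a \<in> multiples R c" using x by (auto simp: multiples_def)
    fix b assume "b \<in> multiples R c"
    then obtain y where y: "y \<in> carrier R" "b = c \<otimes> y" by (auto simp: multiples_def)
    then have "a \<oplus> b = c \<otimes> (x \<oplus> y)" using c x by (simp add: r_distr)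
    then show "a \<oplus> b \<in> multiples R c" using x y by (auto simp: multiples_def)
  qed
  fix a x assume "a \<in> multiples R c" and x: "x \<in> carrier R"
  then obtain y where y: "y \<in> carrier R" "a = c \<otimes> y" by (auto simp: multiples_def)
  have "x \<otimes> a = c \<otimes> (x \<otimes> y)" using c x y central[OF x] by (simp flip: m_assoc)
  then show "x \<otimes> a \<in> multiples R c" using x y by (auto simp: multiples_def)
  have "a \<otimes> x = c \<otimes> (y \<otimes> x)" using c x y by (simp add: m_assoc)
  then show "a \<otimes> x \<in> multiples R c" using x y by (auto simp: multiples_def)
qed

lemma (in ideal) quot_eq_iff:
  assumes "a \<in> carrier R" "b \<in> carrier R"
  shows "I +> a = I +> b \<longleftrightarrow> a \<ominus> b \<in> I"
  using quotient_eq_iff_same_a_r_cos[OF is_ideal] assms by blast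

lemma (in ideal) carrier_quot: "carrier (R Quot I) = (+>) I ` carrier R"
  by (auto simp: FactRing_def A_RCOSETS_def')

lemma (in ring) finsum_only_second:
  fixes n :: nat
  assumes "f 1 \<in> carrier R" "\<And>i. i \<noteq> 1 \<Longrightarrow> f i = \<zero>"
  shows "(\<Oplus>i\<in>{..n}. f i) = (if n = 0 then \<zero> else f 1)"
proof -
  have "(\<Oplus>i\<in>{..n}. f i) = (\<Oplus>i\<in>{..n}. if 1 = i then f i else \<zero>)"
    using assms by (intro finsum_cong') (auto simp: Suc_le_eq Pi_def)
  also have "\<dots> = (if n = 0 then \<zero> else f 1)"
  proof (cases "n = 0")
    case False
    then have "(1::nat) \<in> {..n}" by auto
    moreover have "f \<in> {..n} \<rightarrow> carrier R" using assms by (metis Pi_I zero_closed)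
    ultimately show ?thesis using finsum_singleton[of 1 "{..n}" f] False by simp
  qed simp
  finally show ?thesis .
qed

lemma (in ring) series_T_mult:
  assumes "f \<in> carrier (power_series_ring R)"
  shows "series_T R \<otimes>\<^bsub>power_series_ring R\<^esub> f = (\<lambda>n. if n = 0 then \<zero> else f (n - 1))"
  using assms finsum_only_second[of "\<lambda>i. series_T R i \<otimes> f (_ - i)"]
  by (auto simp: power_series_ring_def series_T_def fun_eq_iff)


section \<open>The completion of a ring at a central element\<close>

locale central_element = ring R for R (structure) +
  fixes N
  assumes N_carrier: "N \<in> carrier R" and N_central: "x \<in> carrier R \<Longrightarrow> N \<otimes> x = x \<otimes> N"
begin

abbreviation proj :: "nat \<Rightarrow> 'a \<Rightarrow> 'a set" where
  "proj m a \<equiv> multiples R (N [^] m) +> a"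

abbreviation Q :: "'a set ring" where
  "Q \<equiv> R Quot multiples R N"

lemma pow_carrier [simp]: "N [^] (m::nat) \<in> carrier R"
  using N_carrier by simp

lemma pow_central: "x \<in> carrier R \<Longrightarrow> N [^] (m::nat) \<otimes> x = x \<otimes> N [^] m"
proof (induction m)
  case (Suc m)
  then show ?case using N_carrier N_central[of x]
    by (simp add: m_assoc) (simp flip: m_assoc)
qed simp

lemma ideal_pow: "ideal (multiples R (N [^] (m::nat))) R"
  by (rule ideal_multiples) (auto simp: pow_central)

lemma proj_eq_iff:
  assumes "a \<in> carrier R" "b \<in> carrier R"
  shows "proj m a = proj m b \<longleftrightarrow> a \<ominus> b \<in> multiples R (N [^] m)"
  using ideal.quot_eq_iff[OF ideal_pow] assms by blast

sublocale one: ideal "multiples R N" R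
  by (rule ideal_multiples) (auto simp: N_central N_carrier)

sublocale Q: ring Q
  by (rule one.quotient_is_ring)

lemma level_simps:
  assumes "a \<in> carrier R" "b \<in> carrier R"
  shows "proj m a \<otimes>\<^bsub>level R N m\<^esub> proj m b = proj m (a \<otimes> b)"
    "proj m a \<oplus>\<^bsub>level R N m\<^esub> proj m b = proj m (a \<oplus> b)"
  using assms ideal.rcoset_mult_add[OF ideal_pow, of a b m]
    ideal.a_rcos_sum[OF ideal_pow, of a b m]
  by (simp_all add: level_def FactRing_def)

lemma level_one: "\<one>\<^bsub>level R N m\<^esub> = proj m \<one>"
  by (simp add: level_def FactRing_def)

lemma proj_level: "a \<in> carrier R \<Longrightarrow> proj m a \<in> carrier (level R N m)"
  by (simp add: level_def ideal.carrier_quot[OF ideal_pow])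

lemma Q_simps:
  assumes "a \<in> carrier R" "b \<in> carrier R"
  shows "(multiples R N +> a) \<otimes>\<^bsub>Q\<^esub> (multiples R N +> b) = multiples R N +> (a \<otimes> b)"
    "(multiples R N +> a) \<oplus>\<^bsub>Q\<^esub> (multiples R N +> b) = multiples R N +> (a \<oplus> b)"
  using assms one.rcoset_mult_add[of a b] one.a_rcos_sum[of a b] by (simp_all add: FactRing_def)

lemma proj_antimono:
  assumes "proj n a = proj n b" "m \<le> n" "a \<in> carrier R" "b \<in> carrier R"
  shows "proj m a = proj m b"
proof -
  have "a \<ominus> b \<in> multiples R (N [^] n)" using assms proj_eq_iff by auto
  then obtain x where x: "x \<in> carrier R" "a \<ominus> b = N [^] n \<otimes> x" by (rule multiplesE)
  have "N [^] n = N [^] m \<otimes> N [^] (n - m)" using assms N_carrier by (simp add: nat_pow_mult)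
  then have "a \<ominus> b = N [^] m \<otimes> (N [^] (n - m) \<otimes> x)" using x by (simp add: m_assoc)
  then have "a \<ominus> b \<in> multiples R (N [^] m)" using x by (intro multiplesI) auto
  then show ?thesis using assms proj_eq_iff by auto
qed

text \<open>The definition asks for a common representative of two levels at a time. Congruence
  modulo N^m implies congruence modulo all lower powers, so a representative of level m serves every
  level up to m. Computations in the completion thus reduce to one element of R.\<close>

lemma adic_carrier_iff:
  "x \<in> carrier (adic_completion R N) \<longleftrightarrow>
     x \<in> extensional {1..} \<and> (\<forall>m\<ge>1. \<exists>a\<in>carrier R. \<forall>k\<in>{1..m}. x k = proj k a)"
  (is "?L \<longleftrightarrow> ?R")
proof
  assume L: ?L
  have compat: "\<exists>a\<in>carrier R. x n = proj n a \<and> x m = proj m a" if "1 \<le> m" "m \<le> n" for m n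
    using L that by (auto simp: adic_completion_def)
  have "\<exists>a\<in>carrier R. \<forall>k\<in>{1..m}. x k = proj k a" if m: "m \<ge> 1" for m
  proof -
    obtain a where a: "a \<in> carrier R" "x m = proj m a" using compat[of m m] m by auto
    have "x k = proj k a" if k: "k \<in> {1..m}" for k
    proof -
      obtain b where "b \<in> carrier R" "x m = proj m b" "x k = proj k b"
        using compat[of k m] k by auto
      then show ?thesis using proj_antimono[of m b a k] a k by auto
    qed
    then show ?thesis using a by blast
  qed
  moreover have "x \<in> extensional {1..}" using L by (auto simp: adic_completion_def PiE_def)
  ultimately show ?R by blast
next
  assume R: ?R
  have compat: "\<exists>a\<in>carrier R. x n = proj n a \<and> x m = proj m a" if "1 \<le> m" "m \<le> n" for m n
    using R[THEN conjunct2, rule_format, of n] that by force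
  have "x m \<in> carrier (level R N m)" if "m \<ge> 1" for m
    using compat[of m m] that proj_level[of _ m] by auto
  then have "x \<in> (\<Pi>\<^sub>E m\<in>{1..}. carrier (level R N m))" using R by (auto simp: PiE_def)
  then show ?L using compat unfolding adic_completion_def by simp
qed

lemma adic_repr:
  assumes "x \<in> carrier (adic_completion R N)"
  obtains a where "a \<in> carrier R" "\<And>k. 1 \<le> k \<Longrightarrow> k \<le> m \<Longrightarrow> x k = proj k a"
proof (cases "m \<ge> 1")
  case True
  then show ?thesis using assms that unfolding adic_carrier_iff by (metis atLeastAtMost_iff)
next
  case False
  then show ?thesis using that[of \<zero>] by auto
qed

lemma adic_mult_eval:
  assumes "1 \<le> m" "x m = proj m a" "y m = proj m b" "a \<in> carrier R" "b \<in> carrier R"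
  shows "(x \<otimes>\<^bsub>adic_completion R N\<^esub> y) m = proj m (a \<otimes> b)"
  using assms by (simp add: adic_completion_def level_simps)

lemma adic_add_eval:
  assumes "1 \<le> m" "x m = proj m a" "y m = proj m b" "a \<in> carrier R" "b \<in> carrier R"
  shows "(x \<oplus>\<^bsub>adic_completion R N\<^esub> y) m = proj m (a \<oplus> b)"
  using assms by (simp add: adic_completion_def level_simps)

lemma adic_one_eval: "1 \<le> m \<Longrightarrow> \<one>\<^bsub>adic_completion R N\<^esub> m = proj m \<one>"
  by (simp add: adic_completion_def level_one)

lemma adic_mult_closed:
  assumes "x \<in> carrier (adic_completion R N)" "y \<in> carrier (adic_completion R N)"
  shows "x \<otimes>\<^bsub>adic_completion R N\<^esub> y \<in> carrier (adic_completion R N)"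
  unfolding adic_carrier_iff
proof (intro conjI allI impI)
  show "x \<otimes>\<^bsub>adic_completion R N\<^esub> y \<in> extensional {1..}" by (simp add: adic_completion_def)
  fix m :: nat assume "1 \<le> m"
  obtain a where a: "a \<in> carrier R" "\<And>k. 1 \<le> k \<Longrightarrow> k \<le> m \<Longrightarrow> x k = proj k a"
    using adic_repr[OF assms(1), of m] by blast
  obtain b where b: "b \<in> carrier R" "\<And>k. 1 \<le> k \<Longrightarrow> k \<le> m \<Longrightarrow> y k = proj k b"
    using adic_repr[OF assms(2), of m] by blast
  show "\<exists>c\<in>carrier R. \<forall>k\<in>{1..m}. (x \<otimes>\<^bsub>adic_completion R N\<^esub> y) k = proj k c"
    using a b by (intro bexI[of _ "a \<otimes> b"]) (auto simp: adic_mult_eval)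
qed

lemma adic_add_closed:
  assumes "x \<in> carrier (adic_completion R N)" "y \<in> carrier (adic_completion R N)"
  shows "x \<oplus>\<^bsub>adic_completion R N\<^esub> y \<in> carrier (adic_completion R N)"
  unfolding adic_carrier_iff
proof (intro conjI allI impI)
  show "x \<oplus>\<^bsub>adic_completion R N\<^esub> y \<in> extensional {1..}" by (simp add: adic_completion_def)
  fix m :: nat assume "1 \<le> m"
  obtain a where a: "a \<in> carrier R" "\<And>k. 1 \<le> k \<Longrightarrow> k \<le> m \<Longrightarrow> x k = proj k a"
    using adic_repr[OF assms(1), of m] by blast
  obtain b where b: "b \<in> carrier R" "\<And>k. 1 \<le> k \<Longrightarrow> k \<le> m \<Longrightarrow> y k = proj k b"
    using adic_repr[OF assms(2), of m] by blast
  show "\<exists>c\<in>carrier R. \<forall>k\<in>{1..m}. (x \<oplus>\<^bsub>adic_completion R N\<^esub> y) k = proj k c"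
    using a b by (intro bexI[of _ "a \<oplus> b"]) (auto simp: adic_add_eval)
qed

lemma to_completion_closed: "a \<in> carrier R \<Longrightarrow> to_completion R N a \<in> carrier (adic_completion R N)"
  unfolding adic_carrier_iff by (auto simp: to_completion_def)

lemma adic_eqI:
  assumes "x \<in> carrier (adic_completion R N)" "y \<in> carrier (adic_completion R N)"
    "\<And>m. 1 \<le> m \<Longrightarrow> x m = y m"
  shows "x = y"
  using assms by (intro extensionalityI[of x "{1..}" y]) (auto simp: adic_carrier_iff)

lemma adic_one_closed: "\<one>\<^bsub>adic_completion R N\<^esub> \<in> carrier (adic_completion R N)"
  unfolding adic_carrier_iff by (auto simp: adic_one_eval) (simp add: adic_completion_def)

lemma to_completion_add:
  assumes "a \<in> carrier R" "b \<in> carrier R"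
  shows "to_completion R N (a \<oplus> b) = to_completion R N a \<oplus>\<^bsub>adic_completion R N\<^esub> to_completion R N b"
  using assms by (intro adic_eqI adic_add_closed to_completion_closed)
    (auto simp: adic_add_eval[where a = a and b = b] to_completion_def)

lemma to_completion_mult:
  assumes "a \<in> carrier R" "b \<in> carrier R"
  shows "to_completion R N (a \<otimes> b) = to_completion R N a \<otimes>\<^bsub>adic_completion R N\<^esub> to_completion R N b"
  using assms by (intro adic_eqI adic_mult_closed to_completion_closed)
    (auto simp: adic_mult_eval[where a = a and b = b] to_completion_def)

section \<open>Extending a homomorphism from R to (R/NR)[[T]] to the completion\<close>

context
  fixes \<Phi> :: "'a \<Rightarrow> nat \<Rightarrow> 'a set"
  assumes hom: "\<Phi> \<in> ring_hom R (quot_series R N)"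
    and \<Phi>_N: "\<Phi> N = series_T Q"
    and \<Phi>_0: "\<And>a. a \<in> carrier R \<Longrightarrow> \<Phi> a 0 = multiples R N +> a"
begin

lemma \<Phi>_closed [simp]: "a \<in> carrier R \<Longrightarrow> \<Phi> a n \<in> carrier Q"
  using ring_hom_closed[OF hom] by (simp add: quot_series_def power_series_ring_def)

lemma \<Phi>_add: "a \<in> carrier R \<Longrightarrow> b \<in> carrier R \<Longrightarrow> \<Phi> (a \<oplus> b) n = \<Phi> a n \<oplus>\<^bsub>Q\<^esub> \<Phi> b n"
  using ring_hom_add[OF hom, of a b] by (simp add: quot_series_def power_series_ring_def)

lemma \<Phi>_mult:
  "a \<in> carrier R \<Longrightarrow> b \<in> carrier R \<Longrightarrow> \<Phi> (a \<otimes> b) n = (\<Oplus>\<^bsub>Q\<^esub>i\<in>{..n}. \<Phi> a i \<otimes>\<^bsub>Q\<^esub> \<Phi> b (n - i))"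
  using ring_hom_mult[OF hom, of a b] by (simp add: quot_series_def power_series_ring_def)

lemma \<Phi>_N_mult:
  assumes "a \<in> carrier R"
  shows "\<Phi> (N \<otimes> a) n = (if n = 0 then \<zero>\<^bsub>Q\<^esub> else \<Phi> a (n - 1))"
  using assms ring_hom_mult[OF hom N_carrier, of a] ring_hom_closed[OF hom, of a]
  by (simp add: \<Phi>_N quot_series_def Q.series_T_mult)

lemma \<Phi>_pow_mult:
  assumes "a \<in> carrier R"
  shows "\<Phi> (N [^] m \<otimes> a) n = (if n < m then \<zero>\<^bsub>Q\<^esub> else \<Phi> a (n - m))"
  using assms
proof (induction m arbitrary: a n)
  case (Suc m)
  have "N [^] Suc m \<otimes> a = N [^] m \<otimes> (N \<otimes> a)" using Suc.prems N_carrier by (simp add: m_assoc)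
  then show ?case using Suc N_carrier by (auto simp: \<Phi>_N_mult)
qed simp

lemma \<Phi>_minus: "a \<in> carrier R \<Longrightarrow> b \<in> carrier R \<Longrightarrow> \<Phi> (a \<ominus> b) n = \<Phi> a n \<ominus>\<^bsub>Q\<^esub> \<Phi> b n"
proof -
  assume a: "a \<in> carrier R" "b \<in> carrier R"
  have "(a \<ominus> b) \<oplus> b = a" using a by (simp add: a_minus_def a_assoc l_neg)
  then have "\<Phi> a n = \<Phi> (a \<ominus> b) n \<oplus>\<^bsub>Q\<^esub> \<Phi> b n" using a \<Phi>_add[of "a \<ominus> b" b n] by simp
  then show ?thesis using a by (simp add: a_minus_def Q.a_assoc Q.r_neg)
qed

lemma \<Phi>_minus_zero:
  assumes "a \<in> carrier R" "b \<in> carrier R" "\<Phi> a n = \<Phi> b n"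
  shows "\<Phi> (a \<ominus> b) n = \<zero>\<^bsub>Q\<^esub>"
  using assms \<Phi>_closed[of b n] by (simp only: \<Phi>_minus) (simp add: a_minus_def Q.r_neg)

text \<open>As N goes to T, a multiple of N^m goes to a multiple of T^m, which is invisible below
  degree m.\<close>

lemma \<Phi>_cong:
  assumes "proj m a = proj m b" "a \<in> carrier R" "b \<in> carrier R" "n < m"
  shows "\<Phi> a n = \<Phi> b n"
proof -
  have "a \<ominus> b \<in> multiples R (N [^] m)" using assms proj_eq_iff by auto
  then obtain x where x: "x \<in> carrier R" "a \<ominus> b = N [^] m \<otimes> x" by (rule multiplesE)
  then have "\<Phi> a n \<ominus>\<^bsub>Q\<^esub> \<Phi> b n = \<zero>\<^bsub>Q\<^esub>"
    using assms by (simp add: \<Phi>_pow_mult flip: \<Phi>_minus)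
  then show ?thesis using assms Q.minus_equality[of "\<Phi> a n" "\<ominus>\<^bsub>Q\<^esub> \<Phi> b n"]
    by (simp add: a_minus_def)
qed

text \<open>Coefficient 0 is the residue modulo N, so its vanishing gives a = N b. The coefficients
  of the image of b are those of the image of a moved down by one, and the argument repeats with
  b.\<close>

lemma \<Phi>_kernel:
  assumes "a \<in> carrier R" "\<And>n. n < m \<Longrightarrow> \<Phi> a n = \<zero>\<^bsub>Q\<^esub>"
  shows "a \<in> multiples R (N [^] m)"
  using assms
proof (induction m arbitrary: a)
  case 0
  then show ?case by (intro multiplesI[of a]) auto
next
  case (Suc m)
  have "multiples R N +> a = multiples R N"
    using Suc.prems \<Phi>_0[of a] by (simp add: FactRing_def)
  then have "a \<in> multiples R N" using Suc.prems one.rcos_const_imp_mem by blast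
  then obtain b where b: "b \<in> carrier R" "a = N \<otimes> b" by (rule multiplesE)
  have "\<Phi> b n = \<zero>\<^bsub>Q\<^esub>" if "n < m" for n
    using \<Phi>_N_mult[of b "Suc n"] b Suc.prems(2)[of "Suc n"] that by simp
  then obtain c where c: "c \<in> carrier R" "b = N [^] m \<otimes> c"
    using Suc.IH[of b] b by (metis multiplesE)
  then have "a = N [^] Suc m \<otimes> c"
    using b N_carrier pow_central[of N m] by (simp flip: m_assoc)
  then show ?case using c by (intro multiplesI) auto
qed

text \<open>Successive approximation: a correction N^m b leaves the coefficients below m alone and
  adds the residue of b to the m-th one, so b is chosen to lift the remaining error.\<close>

lemma \<Phi>_approx:
  assumes f: "\<And>n. f n \<in> carrier Q"
  shows "\<exists>a\<in>carrier R. \<forall>n<m. \<Phi> a n = f n"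
proof (induction m)
  case (Suc m)
  then obtain a where a: "a \<in> carrier R" "\<And>n. n < m \<Longrightarrow> \<Phi> a n = f n" by auto
  have "f m \<ominus>\<^bsub>Q\<^esub> \<Phi> a m \<in> carrier Q" using f a by simp
  then obtain b where b: "b \<in> carrier R" "multiples R N +> b = f m \<ominus>\<^bsub>Q\<^esub> \<Phi> a m"
    unfolding one.carrier_quot by auto
  have "\<Phi> (a \<oplus> N [^] m \<otimes> b) n = f n" if "n < Suc m" for n
  proof (cases "n = m")
    case True
    have "\<Phi> a m \<oplus>\<^bsub>Q\<^esub> (f m \<ominus>\<^bsub>Q\<^esub> \<Phi> a m) = f m"
      using f[of m] \<Phi>_closed[OF a(1), of m]
      by (simp add: a_minus_def Q.a_lcomm Q.r_neg)
    then show ?thesis using a b True by (simp add: \<Phi>_add \<Phi>_pow_mult \<Phi>_0)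
  next
    case False
    then show ?thesis using a b that f[of n] by (simp add: \<Phi>_add \<Phi>_pow_mult)
  qed
  then show ?case using a b by (intro bexI[of _ "a \<oplus> N [^] m \<otimes> b"]) auto
qed auto

text \<open>The first m coefficients of the image of a depend only on a modulo N^m
  (\<open>\<Phi>_cong\<close>), determine it (\<open>\<Phi>_kernel\<close>) and can be prescribed
  (\<open>\<Phi>_approx\<close>). These give well-definedness, injectivity and surjectivity in the
  limit.\<close>

lemma ring_iso_extending:
  "\<exists>\<tau>\<in>ring_iso (adic_completion R N) (quot_series R N).
     (\<forall>a\<in>carrier R. \<tau> (to_completion R N a) = \<Phi> a) \<and>
     (\<forall>x\<in>carrier (adic_completion R N). \<tau> x 0 = x 1)"
proof -
  \<comment> \<open>Coefficient n is determined by the class modulo N^(n+1), hence the level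
    \<open>Suc n\<close>; the choice of representative does not matter by
    \<open>\<tau>_eq\<close>.\<close>
  define \<tau> where
    "\<tau> x n = \<Phi> (SOME a. a \<in> carrier R \<and> x (Suc n) = proj (Suc n) a) n" for x n
  have \<tau>_eq: "\<tau> x n = \<Phi> a n"
    if "a \<in> carrier R" "\<And>k. 1 \<le> k \<Longrightarrow> k \<le> m \<Longrightarrow> x k = proj k a" "n < m" for x n a m
  proof -
    have "\<exists>a. a \<in> carrier R \<and> x (Suc n) = proj (Suc n) a"
      using that(1) that(2)[of "Suc n"] that(3) by auto
    from someI_ex[OF this] show ?thesis
      unfolding \<tau>_def using that by (intro \<Phi>_cong[of "Suc n"]) auto
  qed
  have closed: "\<tau> x \<in> carrier (quot_series R N)" if "x \<in> carrier (adic_completion R N)" for x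
  proof -
    have "\<tau> x n \<in> carrier Q" for n
      by (rule adic_repr[OF that, of "Suc n"]) (use \<tau>_eq[of _ "Suc n" x n] in auto)
    then show ?thesis by (simp add: quot_series_def power_series_ring_def)
  qed
  have "\<tau> \<in> ring_hom (adic_completion R N) (quot_series R N)"
  proof (rule ring_hom_memI)
    fix x y assume x: "x \<in> carrier (adic_completion R N)" and y: "y \<in> carrier (adic_completion R N)"
    show "\<tau> (x \<otimes>\<^bsub>adic_completion R N\<^esub> y) = \<tau> x \<otimes>\<^bsub>quot_series R N\<^esub> \<tau> y"
    proof
      fix n
      obtain a where a: "a \<in> carrier R" "\<And>k. 1 \<le> k \<Longrightarrow> k \<le> Suc n \<Longrightarrow> x k = proj k a"
        using adic_repr[OF x] by blast
      obtain b where b: "b \<in> carrier R" "\<And>k. 1 \<le> k \<Longrightarrow> k \<le> Suc n \<Longrightarrow> y k = proj k b"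
        using adic_repr[OF y] by blast
      have "\<tau> (x \<otimes>\<^bsub>adic_completion R N\<^esub> y) n = \<Phi> (a \<otimes> b) n"
        using a b by (intro \<tau>_eq[of _ "Suc n"] adic_mult_eval) auto
      also have "\<dots> = (\<Oplus>\<^bsub>Q\<^esub>i\<in>{..n}. \<tau> x i \<otimes>\<^bsub>Q\<^esub> \<tau> y (n - i))"
        unfolding \<Phi>_mult[OF a(1) b(1)]
        using \<tau>_eq[OF a] \<tau>_eq[OF b] a b by (intro Q.finsum_cong') auto
      finally show "\<tau> (x \<otimes>\<^bsub>adic_completion R N\<^esub> y) n = (\<tau> x \<otimes>\<^bsub>quot_series R N\<^esub> \<tau> y) n"
        by (simp add: quot_series_def power_series_ring_def)
    qed
    show "\<tau> (x \<oplus>\<^bsub>adic_completion R N\<^esub> y) = \<tau> x \<oplus>\<^bsub>quot_series R N\<^esub> \<tau> y"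
    proof
      fix n
      obtain a where a: "a \<in> carrier R" "\<And>k. 1 \<le> k \<Longrightarrow> k \<le> Suc n \<Longrightarrow> x k = proj k a"
        using adic_repr[OF x] by blast
      obtain b where b: "b \<in> carrier R" "\<And>k. 1 \<le> k \<Longrightarrow> k \<le> Suc n \<Longrightarrow> y k = proj k b"
        using adic_repr[OF y] by blast
      have "\<tau> (x \<oplus>\<^bsub>adic_completion R N\<^esub> y) n = \<Phi> (a \<oplus> b) n"
        using a b by (intro \<tau>_eq[of _ "Suc n"] adic_add_eval) auto
      moreover have "\<tau> x n = \<Phi> a n" "\<tau> y n = \<Phi> b n"
        using \<tau>_eq[OF a lessI] \<tau>_eq[OF b lessI] by blast+
      ultimately show "\<tau> (x \<oplus>\<^bsub>adic_completion R N\<^esub> y) n = (\<tau> x \<oplus>\<^bsub>quot_series R N\<^esub> \<tau> y) n"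
        using a b \<Phi>_add[of a b n]
        by (simp add: quot_series_def power_series_ring_def)
    qed
  next
    show "\<tau> \<one>\<^bsub>adic_completion R N\<^esub> = \<one>\<^bsub>quot_series R N\<^esub>"
    proof
      fix n
      have "\<tau> \<one>\<^bsub>adic_completion R N\<^esub> n = \<Phi> \<one> n"
        by (rule \<tau>_eq[of _ "Suc n"]) (auto simp: adic_one_eval)
      then show "\<tau> \<one>\<^bsub>adic_completion R N\<^esub> n = \<one>\<^bsub>quot_series R N\<^esub> n"
        using ring_hom_one[OF hom] by simp
    qed
  qed (rule closed)
  moreover have "inj_on \<tau> (carrier (adic_completion R N))"
  proof (rule inj_onI)
    fix x y assume x: "x \<in> carrier (adic_completion R N)" and y: "y \<in> carrier (adic_completion R N)"
      and eq: "\<tau> x = \<tau> y"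
    show "x = y"
    proof (rule adic_eqI[OF x y])
      fix m :: nat assume m: "1 \<le> m"
      obtain a where a: "a \<in> carrier R" "\<And>k. 1 \<le> k \<Longrightarrow> k \<le> m \<Longrightarrow> x k = proj k a"
        using adic_repr[OF x, of m] by blast
      obtain b where b: "b \<in> carrier R" "\<And>k. 1 \<le> k \<Longrightarrow> k \<le> m \<Longrightarrow> y k = proj k b"
        using adic_repr[OF y, of m] by blast
      have "\<Phi> a n = \<Phi> b n" if "n < m" for n
        using \<tau>_eq[OF a that] \<tau>_eq[OF b that] eq by simp
      then have "a \<ominus> b \<in> multiples R (N [^] m)"
        using a b by (intro \<Phi>_kernel \<Phi>_minus_zero) auto
      then show "x m = y m" using a b m proj_eq_iff[of a b m] by simp
    qed
  qed
  moreover have "carrier (quot_series R N) \<subseteq> \<tau> ` carrier (adic_completion R N)"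
  proof
    fix f assume "f \<in> carrier (quot_series R N)"
    then have f: "\<And>n. f n \<in> carrier Q" by (simp add: quot_series_def power_series_ring_def)
    obtain a where a: "\<And>m. a m \<in> carrier R" "\<And>m n. n < m \<Longrightarrow> \<Phi> (a m) n = f n"
      using \<Phi>_approx[of f, OF f] by metis
    define x where "x = (\<lambda>m\<in>{1..}. proj m (a m))"
    \<comment> \<open>The approximations \<open>a k\<close> and \<open>a m\<close> have the same
      first k coefficients, so they are congruent modulo N^k and form a compatible family.\<close>
    have x_eq: "x k = proj k (a m)" if "1 \<le> k" "k \<le> m" for k m
    proof -
      have "a k \<ominus> a m \<in> multiples R (N [^] k)"
        using a that by (intro \<Phi>_kernel \<Phi>_minus_zero) auto
      then show ?thesis using a that proj_eq_iff[of "a k" "a m" k] by (simp add: x_def)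
    qed
    have "x \<in> carrier (adic_completion R N)"
      unfolding adic_carrier_iff
    proof (intro conjI allI impI)
      show "x \<in> extensional {1..}" by (simp add: x_def)
      show "\<exists>b\<in>carrier R. \<forall>k\<in>{1..m}. x k = proj k b" for m
        using a x_eq by (intro bexI[of _ "a m"]) auto
    qed
    moreover have "\<tau> x = f"
    proof
      fix n
      have "\<tau> x n = \<Phi> (a (Suc n)) n" using a x_eq by (intro \<tau>_eq[of _ "Suc n"]) auto
      then show "\<tau> x n = f n" using a by simp
    qed
    ultimately show "f \<in> \<tau> ` carrier (adic_completion R N)" by auto
  qed
  ultimately have "\<tau> \<in> ring_iso (adic_completion R N) (quot_series R N)"
    using closed by (auto simp: ring_iso_def bij_betw_def)
  moreover have "\<tau> (to_completion R N a) = \<Phi> a" if "a \<in> carrier R" for a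
  proof
    show "\<tau> (to_completion R N a) n = \<Phi> a n" for n
      using that by (intro \<tau>_eq[of _ "Suc n"]) (auto simp: to_completion_def)
  qed
  moreover have "\<tau> x 0 = x 1" if x: "x \<in> carrier (adic_completion R N)" for x
  proof -
    obtain a where a: "a \<in> carrier R" "\<And>k. 1 \<le> k \<Longrightarrow> k \<le> 1 \<Longrightarrow> x k = proj k a"
      using adic_repr[OF x, of 1] by blast
    then show ?thesis using \<tau>_eq[OF a zero_less_one] a(2)[of 1] \<Phi>_0[of a] N_carrier by simp
  qed
  ultimately show ?thesis by blast
qed

end

text \<open>Lets an element of the completion be peeled off one power of N at a time. Division by N
  is carried out on the other side of \<tau>: the constant terms of the images of x and c agree, and
  \<open>g\<close> is the difference of these images divided by T.\<close>

lemma adic_decomposition: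
  assumes \<tau>: "\<tau> \<in> ring_iso (adic_completion R N) (quot_series R N)"
    and \<tau>_N: "\<tau> (to_completion R N N) = series_T Q"
    and \<tau>_0: "\<forall>x\<in>carrier (adic_completion R N). \<tau> x 0 = x 1"
    and x: "x \<in> carrier (adic_completion R N)"
  obtains c y where "c \<in> carrier R" "y \<in> carrier (adic_completion R N)"
    "x = to_completion R N c \<oplus>\<^bsub>adic_completion R N\<^esub>
           (to_completion R N N \<otimes>\<^bsub>adic_completion R N\<^esub> y)"
proof -
  have hom: "\<tau> \<in> ring_hom (adic_completion R N) (quot_series R N)"
    and bij: "bij_betw \<tau> (carrier (adic_completion R N)) (carrier (quot_series R N))"
    using \<tau> by (auto simp: ring_iso_def)
  obtain c where c: "c \<in> carrier R" "x 1 = proj 1 c"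
    using adic_repr[OF x, of 1] by (metis order_refl)
  let ?c = "to_completion R N c"
  have cc: "?c \<in> carrier (adic_completion R N)" using c by (simp add: to_completion_closed)
  have carr: "\<tau> z n \<in> carrier Q" if "z \<in> carrier (adic_completion R N)" for z n
    using ring_hom_closed[OF hom that] by (simp add: quot_series_def power_series_ring_def)
  define g where "g n = \<tau> x (Suc n) \<ominus>\<^bsub>Q\<^esub> \<tau> ?c (Suc n)" for n
  have g: "g \<in> carrier (quot_series R N)"
    using carr x cc by (simp add: g_def quot_series_def power_series_ring_def)
  then obtain y where y: "y \<in> carrier (adic_completion R N)" "\<tau> y = g"
    using bij by (metis bij_betw_iff_bijections)
  let ?z = "to_completion R N N \<otimes>\<^bsub>adic_completion R N\<^esub> y"
  have N: "to_completion R N N \<in> carrier (adic_completion R N)"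
    by (simp add: to_completion_closed N_carrier)
  have z: "?z \<in> carrier (adic_completion R N)" using y N by (simp add: adic_mult_closed)
  have tz: "\<tau> ?z = (\<lambda>n. if n = 0 then \<zero>\<^bsub>Q\<^esub> else g (n - 1))"
    using ring_hom_mult[OF hom N y(1)] y g by (simp add: \<tau>_N quot_series_def Q.series_T_mult)
  have "\<tau> (?c \<oplus>\<^bsub>adic_completion R N\<^esub> ?z) n = \<tau> x n" for n
  proof (cases n)
    case 0
    then show ?thesis
      using cc z x c ring_hom_add[OF hom cc z] \<tau>_0 tz carr[OF cc, of 0]
      by (simp add: quot_series_def power_series_ring_def to_completion_def)
  next
    case (Suc k)
    then show ?thesis
      using cc z x ring_hom_add[OF hom cc z] tz carr[OF cc, of n] carr[OF x, of n]
      by (simp add: quot_series_def power_series_ring_def g_def a_minus_def Q.a_lcomm Q.r_neg)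
  qed
  then have "\<tau> (?c \<oplus>\<^bsub>adic_completion R N\<^esub> ?z) = \<tau> x" by auto
  then have "x = ?c \<oplus>\<^bsub>adic_completion R N\<^esub> ?z"
    using bij adic_add_closed[OF cc z] x by (metis bij_betw_def inj_onD)
  then show thesis using c y that by blast
qed

end


subsection \<open>Iterates of bijections\<close>

lemma int_funpow_0 [simp]: "int_funpow f 0 x = x"
  by (simp add: int_funpow_def)

lemma int_funpow_of_nat: "int_funpow f (int n) = f ^^ n"
  by (simp add: int_funpow_def)

lemma int_funpow_1 [simp]: "int_funpow f 1 = f"
  using int_funpow_of_nat[of f 1] by simp

lemma int_funpow_succ:
  assumes "bij f"
  shows "int_funpow f (i + 1) x = f (int_funpow f i x)"
proof (cases "i \<ge> 0")
  case True
  then have "nat (i + 1) = Suc (nat i)" by simp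
  then show ?thesis using True by (simp add: int_funpow_def)
next
  case False
  then have "nat (- i) = Suc (nat (- (i + 1)))" by simp
  then show ?thesis using False assms
    by (auto simp: int_funpow_def bij_is_surj surj_f_inv_f)
qed

lemma int_funpow_pred:
  assumes "bij f"
  shows "int_funpow f (i - 1) x = inv_into UNIV f (int_funpow f i x)"
  using int_funpow_succ[OF assms, of "i - 1" x] assms by (simp add: bij_is_inj)

lemma int_funpow_add:
  assumes "bij f"
  shows "int_funpow f (i + j) x = int_funpow f i (int_funpow f j x)"
proof (induction i rule: int_induct[where k = 0])
  case (step1 i)
  then show ?case
    using int_funpow_succ[OF assms, of "i + j" x] int_funpow_succ[OF assms, of i]
    by (simp add: add.assoc add.commute add.left_commute)
next
  case (step2 i)
  then show ?case
    using int_funpow_pred[OF assms, of "i + j" x] int_funpow_pred[OF assms, of i]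
    by (simp add: algebra_simps)
qed simp

lemma dvd_int_induct [consumes 1, case_names zero add diff]:
  assumes "int r dvd i" "P 0" "\<And>i. int r dvd i \<Longrightarrow> P i \<Longrightarrow> P (i + int r)"
    "\<And>i. int r dvd i \<Longrightarrow> P i \<Longrightarrow> P (i - int r)"
  shows "P i"
proof -
  have "P (int r * m)" for m
  proof (induction m rule: int_induct[where k = 0])
    case (step1 m)
    then show ?case using assms(3)[of "int r * m"] by (simp add: algebra_simps)
  next
    case (step2 m)
    then show ?case using assms(4)[of "int r * m"] by (simp add: algebra_simps)
  qed (use assms in simp)
  then show ?thesis using assms(1) by auto
qed


subsection \<open>Skew Laurent polynomials\<close>

text \<open>The predicate \<open>V\<close> carries conditions on exponents and coefficients, such as
  divisibility by r or invariance under \<theta>, through the induction.\<close>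

lemma poly_mapping_single_induct [consumes 1, case_names zero add]:
  fixes f :: "'a \<Rightarrow>\<^sub>0 'b::comm_monoid_add"
  assumes "\<forall>i\<in>Poly_Mapping.keys f. V i (Poly_Mapping.lookup f i)"
    and "P 0"
    and "\<And>i c f. V i c \<Longrightarrow> \<forall>i\<in>Poly_Mapping.keys f. V i (Poly_Mapping.lookup f i) \<Longrightarrow>
           P f \<Longrightarrow> P (Poly_Mapping.single i c + f)"
  shows "P f"
  using assms(1)
proof (induction f rule: update_induct)
  case (update f a b)
  have eq: "Poly_Mapping.update a b f = Poly_Mapping.single a b + f"
    using update.hyps
    by (intro poly_mapping_eqI) (auto simp: lookup_update lookup_add lookup_single when_def in_keys_iff)
  have "V a b" "\<forall>i\<in>Poly_Mapping.keys f. V i (Poly_Mapping.lookup f i)"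
    using update.prems update.hyps
    by (auto simp: keys_update lookup_update split: if_splits)
  then show ?case unfolding eq using update.IH by (intro assms(3)) auto
qed (rule assms)

definition skew_mult :: "('k::field \<Rightarrow> 'k) \<Rightarrow> (int \<Rightarrow>\<^sub>0 'k) \<Rightarrow> (int \<Rightarrow>\<^sub>0 'k) \<Rightarrow> (int \<Rightarrow>\<^sub>0 'k)" where
  "skew_mult \<theta> = monoid.mult (skew_laurent \<theta>)"

lemma skew_laurent_eq: "skew_laurent \<theta> = laurent_C \<theta> 1"
  by (simp add: laurent_C_def skew_laurent_def)

lemma laurent_C_simps:
  "carrier (laurent_C \<theta> d) = {f. \<forall>i\<in>Poly_Mapping.keys f. int d dvd i}"
  "f \<otimes>\<^bsub>laurent_C \<theta> d\<^esub> g = skew_mult \<theta> f g"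
  "f \<oplus>\<^bsub>laurent_C \<theta> d\<^esub> g = f + g"
  "\<one>\<^bsub>laurent_C \<theta> d\<^esub> = 1"
  "\<zero>\<^bsub>laurent_C \<theta> d\<^esub> = 0"
  by (simp_all add: laurent_C_def skew_mult_def skew_laurent_def)

lemma laurent_Z_simps:
  "f \<otimes>\<^bsub>laurent_Z \<theta> d\<^esub> g = skew_mult \<theta> f g"
  "f \<oplus>\<^bsub>laurent_Z \<theta> d\<^esub> g = f + g"
  "\<one>\<^bsub>laurent_Z \<theta> d\<^esub> = 1"
  "\<zero>\<^bsub>laurent_Z \<theta> d\<^esub> = 0"
  by (simp_all add: laurent_Z_def skew_mult_def skew_laurent_def)

locale finite_order_automorphism =
  fixes \<theta> :: "'k::field \<Rightarrow> 'k" and r :: nat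
  assumes aut: "field_automorphism \<theta>" and order: "has_order \<theta> r"
begin

abbreviation pow :: "int \<Rightarrow> 'k \<Rightarrow> 'k" where "pow \<equiv> int_funpow \<theta>"

abbreviation sm :: "(int \<Rightarrow>\<^sub>0 'k) \<Rightarrow> (int \<Rightarrow>\<^sub>0 'k) \<Rightarrow> (int \<Rightarrow>\<^sub>0 'k)" (infixl "\<star>" 70) where
  "sm \<equiv> skew_mult \<theta>"

lemma bij: "bij \<theta>" and \<theta>_1: "\<theta> 1 = 1" and \<theta>_add: "\<theta> (a + b) = \<theta> a + \<theta> b"
  and \<theta>_mult: "\<theta> (a * b) = \<theta> a * \<theta> b"
  using aut by (simp_all add: field_automorphism_def)

lemma r_pos: "r > 0"
  using order by (simp add: has_order_def)

lemma inv_\<theta>: "\<theta> (inv_into UNIV \<theta> a) = a"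
  using bij by (simp add: bij_is_surj surj_f_inv_f)

lemma \<theta>_eq_iff: "\<theta> a = \<theta> b \<longleftrightarrow> a = b"
  using bij by (simp add: bij_is_inj inj_eq)

lemma pow_add: "pow i (a + b) = pow i a + pow i b"
proof (induction i rule: int_induct[where k = 0])
  case (step1 i)
  then show ?case by (simp add: int_funpow_succ[OF bij] \<theta>_add)
next
  case (step2 i)
  then show ?case
    by (subst \<theta>_eq_iff[symmetric]) (simp add: int_funpow_pred[OF bij] inv_\<theta> \<theta>_add)
qed simp

lemma pow_mult: "pow i (a * b) = pow i a * pow i b"
proof (induction i rule: int_induct[where k = 0])
  case (step1 i)
  then show ?case by (simp add: int_funpow_succ[OF bij] \<theta>_mult)
next
  case (step2 i)
  then show ?case
    by (subst \<theta>_eq_iff[symmetric]) (simp add: int_funpow_pred[OF bij] inv_\<theta> \<theta>_mult)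
qed simp

lemma pow_0 [simp]: "pow i 0 = 0"
  using pow_add[of i 0 0] by (metis add_0 add_cancel_right_right)

lemma pow_1 [simp]: "pow i 1 = 1"
proof (induction i rule: int_induct[where k = 0])
  case (step2 i)
  then show ?case using int_funpow_pred[OF bij, of i 1] \<theta>_1 bij
    by (metis bij_is_inj inv_f_f)
qed (simp_all add: int_funpow_succ[OF bij] \<theta>_1)

lemma pow_sum: "pow i (sum f A) = (\<Sum>a\<in>A. pow i (f a))"
  by (induction A rule: infinite_finite_induct) (simp_all add: pow_add)

lemma pow_fixed: "\<theta> a = a \<Longrightarrow> pow i a = a"
proof (induction i rule: int_induct[where k = 0])
  case (step2 i)
  then show ?case
    by (subst \<theta>_eq_iff[symmetric]) (simp add: int_funpow_pred[OF bij] inv_\<theta>)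
qed (simp_all add: int_funpow_succ[OF bij])

lemma pow_dvd: "int r dvd i \<Longrightarrow> pow i a = a"
proof (induction i rule: dvd_int_induct)
  case (add i)
  then show ?case using order
    by (simp add: int_funpow_add[OF bij, of i "int r"] int_funpow_of_nat has_order_def)
next
  case (diff i)
  have "pow (i - int r + int r) a = pow (i - int r) a"
    using order unfolding int_funpow_add[OF bij, of "i - int r" "int r"]
    by (simp add: int_funpow_of_nat has_order_def)
  then show ?case using diff by simp
qed simp

lemma \<theta>_of_int: "\<theta> (of_int k) = of_int k"
proof (induction k rule: int_induct[where k = 0])
  case (step2 i)
  have "\<theta> (of_int (i - 1)) + 1 = \<theta> (of_int (i - 1) + 1)" by (simp only: \<theta>_add \<theta>_1)
  also have "\<dots> = of_int i" using step2 by simp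
  finally show ?case by (simp add: eq_diff_eq)
qed (use pow_0[of 1] in \<open>simp_all add: \<theta>_add \<theta>_1\<close>)

lemma skew_mult_expand:
  assumes "finite A" "finite B" "Poly_Mapping.keys f \<subseteq> A" "Poly_Mapping.keys g \<subseteq> B"
  shows "f \<star> g = (\<Sum>i\<in>A. \<Sum>j\<in>B. Poly_Mapping.single (i + j)
           (Poly_Mapping.lookup f i * pow i (Poly_Mapping.lookup g j)))"
proof -
  have "f \<star> g = (\<Sum>i\<in>Poly_Mapping.keys f. \<Sum>j\<in>Poly_Mapping.keys g. Poly_Mapping.single (i + j)
           (Poly_Mapping.lookup f i * pow i (Poly_Mapping.lookup g j)))"
    by (simp add: skew_mult_def skew_laurent_def)
  also have "\<dots> = (\<Sum>i\<in>Poly_Mapping.keys f. \<Sum>j\<in>B. Poly_Mapping.single (i + j)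
           (Poly_Mapping.lookup f i * pow i (Poly_Mapping.lookup g j)))"
    using assms by (intro sum.cong sum.mono_neutral_left) (auto simp: in_keys_iff)
  also have "\<dots> = (\<Sum>i\<in>A. \<Sum>j\<in>B. Poly_Mapping.single (i + j)
           (Poly_Mapping.lookup f i * pow i (Poly_Mapping.lookup g j)))"
    using assms by (intro sum.mono_neutral_left) (auto simp: in_keys_iff)
  finally show ?thesis .
qed

lemma skew_mult_single: "Poly_Mapping.single i a \<star> Poly_Mapping.single j b =
    Poly_Mapping.single (i + j) (a * pow i b)"
  by (subst skew_mult_expand[of "{i}" "{j}"]) (auto split: if_splits)

lemma skew_mult_add_left: "(f + g) \<star> h = f \<star> h + g \<star> h"
proof -
  let ?A = "Poly_Mapping.keys f \<union> Poly_Mapping.keys g" and ?B = "Poly_Mapping.keys h"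
  have "Poly_Mapping.keys (f + g) \<subseteq> ?A" by (rule keys_add)
  then show ?thesis
    by (simp add: skew_mult_expand[of ?A ?B] lookup_add distrib_right single_add sum.distrib)
qed

lemma skew_mult_add_right: "h \<star> (f + g) = h \<star> f + h \<star> g"
proof -
  let ?A = "Poly_Mapping.keys f \<union> Poly_Mapping.keys g" and ?B = "Poly_Mapping.keys h"
  have "Poly_Mapping.keys (f + g) \<subseteq> ?A" by (rule keys_add)
  then show ?thesis
    by (simp add: skew_mult_expand[of ?B ?A] lookup_add distrib_left pow_add single_add sum.distrib)
qed

lemma skew_mult_0 [simp]: "0 \<star> h = 0" "h \<star> 0 = 0"
  using skew_mult_add_left[of 0 0 h] skew_mult_add_right[of h 0 0]
  by (metis add_0 add_cancel_right_right)+

lemma skew_mult_sum_left: "sum f A \<star> h = (\<Sum>a\<in>A. f a \<star> h)"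
  by (induction A rule: infinite_finite_induct) (simp_all add: skew_mult_add_left)

lemma skew_mult_sum_right: "h \<star> sum f A = (\<Sum>a\<in>A. h \<star> f a)"
  by (induction A rule: infinite_finite_induct) (simp_all add: skew_mult_add_right)

lemma any_single_induct [case_names zero add]:
  fixes f :: "int \<Rightarrow>\<^sub>0 'k"
  assumes "P 0" and "\<And>i c f. P f \<Longrightarrow> P (Poly_Mapping.single i c + f)"
  shows "P f"
  using poly_mapping_single_induct[of f "\<lambda>_ _. True" P] assms by simp

lemma skew_mult_assoc: "f \<star> g \<star> h = f \<star> (g \<star> h)"
proof (induction f rule: any_single_induct)
  case (add i a f)
  have "Poly_Mapping.single i a \<star> g \<star> h = Poly_Mapping.single i a \<star> (g \<star> h)"
  proof (induction g rule: any_single_induct)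
    case (add j b g)
    have "Poly_Mapping.single i a \<star> Poly_Mapping.single j b \<star> h =
        Poly_Mapping.single i a \<star> (Poly_Mapping.single j b \<star> h)"
      by (induction h rule: any_single_induct)
        (simp_all add: skew_mult_add_right skew_mult_single pow_mult int_funpow_add[OF bij] ac_simps)
    then show ?case by (simp add: add skew_mult_add_left skew_mult_add_right)
  qed simp
  then show ?case by (simp add: add skew_mult_add_left)
qed simp

lemma skew_mult_1 [simp]: "1 \<star> f = f" "f \<star> 1 = f"
proof -
  have "Poly_Mapping.single 0 1 \<star> f = f" "f \<star> Poly_Mapping.single 0 1 = f"
    by (induction f rule: any_single_induct)
      (simp_all add: skew_mult_add_left skew_mult_add_right skew_mult_single del: single_one)
  then show "1 \<star> f = f" "f \<star> 1 = f" by simp_all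
qed

text \<open>For r dividing i the power \<theta>^i is the identity, so moving X^i past a coefficient
  does not twist it.\<close>

lemma skew_mult_eq_mult:
  assumes "\<forall>i\<in>Poly_Mapping.keys f. int r dvd i"
  shows "f \<star> g = f * g"
  using assms
proof (induction f rule: poly_mapping_single_induct)
  case (add i c f)
  have "Poly_Mapping.single i c \<star> g = Poly_Mapping.single i c * g"
    using pow_dvd[OF add(1)] by (induction g rule: any_single_induct)
      (simp_all add: skew_mult_add_right skew_mult_single mult_single distrib_left)
  then show ?case using add by (simp add: skew_mult_add_left distrib_right)
qed simp


subsection \<open>The subrings\<close>

abbreviation S :: "nat \<Rightarrow> (int \<Rightarrow>\<^sub>0 'k) set" where
  "S d \<equiv> carrier (laurent_C \<theta> d)"

abbreviation Z :: "(int \<Rightarrow>\<^sub>0 'k) set" where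
  "Z \<equiv> carrier (laurent_Z \<theta> r)"

lemma S_iff: "f \<in> S d \<longleftrightarrow> (\<forall>i. Poly_Mapping.lookup f i \<noteq> 0 \<longrightarrow> int d dvd i)"
  by (auto simp: laurent_C_simps in_keys_iff)

lemma S_add: "f \<in> S d \<Longrightarrow> g \<in> S d \<Longrightarrow> f + g \<in> S d"
  unfolding S_iff lookup_add by (metis add.right_neutral add_cancel_right_left)

lemma S_0: "0 \<in> S d" and S_1: "1 \<in> S d" and S_uminus: "f \<in> S d \<Longrightarrow> - f \<in> S d"
  by (auto simp: S_iff lookup_one when_def)

lemma S_sum: "(\<And>a. a \<in> A \<Longrightarrow> f a \<in> S d) \<Longrightarrow> sum f A \<in> S d"
  by (induction A rule: infinite_finite_induct) (auto intro: S_add S_0)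

lemma S_single: "int d dvd i \<Longrightarrow> Poly_Mapping.single i c \<in> S d"
  by (auto simp: S_iff lookup_single when_def split: if_splits)

lemma S_mult:
  assumes "f \<in> S d" "g \<in> S d"
  shows "f \<star> g \<in> S d"
proof -
  have "f \<star> g = (\<Sum>i\<in>Poly_Mapping.keys f. \<Sum>j\<in>Poly_Mapping.keys g. Poly_Mapping.single (i + j)
           (Poly_Mapping.lookup f i * pow i (Poly_Mapping.lookup g j)))"
    by (rule skew_mult_expand) auto
  also have "\<dots> \<in> S d"
    using assms by (intro S_sum S_single dvd_add) (auto simp: laurent_C_simps(1))
  finally show ?thesis .
qed

lemma ring_S: "ring (laurent_C \<theta> d)"
proof (rule ringI)
  show "abelian_group (laurent_C \<theta> d)"
  proof (rule abelian_groupI)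
    show "\<exists>y\<in>S d. y \<oplus>\<^bsub>laurent_C \<theta> d\<^esub> x = \<zero>\<^bsub>laurent_C \<theta> d\<^esub>" if "x \<in> S d" for x
      using S_uminus[OF that] by (intro bexI[of _ "- x"]) (simp_all add: laurent_C_simps(3,5))
  qed (simp_all add: S_add S_0 laurent_C_simps(3,5) ac_simps)
  show "monoid (laurent_C \<theta> d)"
    by (rule monoidI) (simp_all add: S_mult S_1 laurent_C_simps(2,4) skew_mult_assoc)
qed (simp_all add: laurent_C_simps(2,3) skew_mult_add_left skew_mult_add_right)

lemma Z_iff: "f \<in> Z \<longleftrightarrow> f \<in> S r \<and> (\<forall>i. \<theta> (Poly_Mapping.lookup f i) = Poly_Mapping.lookup f i)"
  by (simp add: laurent_Z_def laurent_C_simps(1))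

lemma Z_add: "f \<in> Z \<Longrightarrow> g \<in> Z \<Longrightarrow> f + g \<in> Z"
  unfolding Z_iff by (simp add: S_add lookup_add \<theta>_add)

lemma \<theta>_0: "\<theta> 0 = 0"
  using pow_0[of 1] by simp

lemma \<theta>_uminus: "\<theta> (- a) = - \<theta> a"
  using \<theta>_add[of a "- a"] by (simp add: \<theta>_0 add_eq_0_iff)

lemma Z_0: "0 \<in> Z" and Z_1: "1 \<in> Z" and Z_uminus: "f \<in> Z \<Longrightarrow> - f \<in> Z"
  unfolding Z_iff by (auto simp: S_0 S_1 S_uminus lookup_one when_def \<theta>_0 \<theta>_1 \<theta>_uminus)

lemma Z_sum: "(\<And>a. a \<in> A \<Longrightarrow> f a \<in> Z) \<Longrightarrow> sum f A \<in> Z"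
  by (induction A rule: infinite_finite_induct) (auto intro: Z_add Z_0)

lemma Z_single: "int r dvd i \<Longrightarrow> \<theta> c = c \<Longrightarrow> Poly_Mapping.single i c \<in> Z"
  unfolding Z_iff by (auto simp: S_single lookup_single when_def \<theta>_0)

lemma S_mono: "d dvd r \<Longrightarrow> S r \<subseteq> S d"
  unfolding laurent_C_simps by (auto intro: dvd_trans[of "int d" "int r"])

lemma Z_subset: "d dvd r \<Longrightarrow> f \<in> Z \<Longrightarrow> f \<in> S d"
  using S_mono Z_iff by blast

lemma Z_left: "z \<in> Z \<Longrightarrow> z \<star> f = z * f"
  by (rule skew_mult_eq_mult) (simp add: Z_iff laurent_C_simps)

text \<open>Coefficients fixed by \<theta> pass unchanged through every power of X standing to their
  left.\<close>

lemma Z_right: 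
  assumes "z \<in> Z"
  shows "f \<star> z = z * f"
proof -
  have "\<forall>j\<in>Poly_Mapping.keys z. \<theta> (Poly_Mapping.lookup z j) = Poly_Mapping.lookup z j"
    using assms by (simp add: Z_iff)
  then show ?thesis
  proof (induction z rule: poly_mapping_single_induct)
    case (add j c z)
    have "f \<star> Poly_Mapping.single j c = Poly_Mapping.single j c * f"
      using pow_fixed[OF add(1)] by (induction f rule: any_single_induct)
        (simp_all add: skew_mult_add_left skew_mult_single mult_single distrib_left ac_simps)
    then show ?case using add by (simp add: skew_mult_add_right distrib_right)
  qed simp
qed

lemma Z_mult: 
  assumes "f \<in> Z" "g \<in> Z"
  shows "f * g \<in> Z"
proof -
  have "f \<star> g = (\<Sum>i\<in>Poly_Mapping.keys f. \<Sum>j\<in>Poly_Mapping.keys g. Poly_Mapping.single (i + j)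
           (Poly_Mapping.lookup f i * pow i (Poly_Mapping.lookup g j)))"
    by (rule skew_mult_expand) auto
  also have "\<dots> \<in> Z"
    using assms by (intro Z_sum Z_single)
      (auto simp: Z_iff laurent_C_simps(1) \<theta>_mult pow_fixed)
  finally show ?thesis using assms by (simp add: Z_left)
qed

lemma S_Z_mult: "d dvd r \<Longrightarrow> z \<in> Z \<Longrightarrow> f \<in> S d \<Longrightarrow> z * f \<in> S d"
  using S_mult[of z d f] Z_subset[of d z] by (simp add: Z_left)

lemma skew_mult_Z_left: "z \<in> Z \<Longrightarrow> (z * f) \<star> g = z * (f \<star> g)"
  by (simp add: skew_mult_assoc flip: Z_left)

lemma skew_mult_Z_right: "z \<in> Z \<Longrightarrow> f \<star> (z * g) = z * (f \<star> g)"
  by (simp add: Z_right skew_mult_assoc flip: Z_right)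

lemma central: "d dvd r \<Longrightarrow> z \<in> Z \<Longrightarrow> central_element (laurent_C \<theta> d) z"
  by (intro central_element.intro ring_S central_element_axioms.intro)
    (simp_all add: Z_subset laurent_C_simps(2) Z_left Z_right)

lemma cring_Z: "cring (laurent_Z \<theta> r)"
proof (rule cringI)
  show "abelian_group (laurent_Z \<theta> r)"
  proof (rule abelian_groupI)
    show "\<exists>y\<in>Z. y \<oplus>\<^bsub>laurent_Z \<theta> r\<^esub> x = \<zero>\<^bsub>laurent_Z \<theta> r\<^esub>" if "x \<in> Z" for x
      using Z_uminus[OF that] by (intro bexI[of _ "- x"]) (simp_all add: laurent_Z_simps)
  qed (simp_all add: Z_add Z_0 laurent_Z_simps ac_simps)
  show "Group.comm_monoid (laurent_Z \<theta> r)"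
    by (rule comm_monoidI) (simp_all add: Z_1 Z_mult Z_left laurent_Z_simps ac_simps)
qed (simp_all add: laurent_Z_simps skew_mult_add_left)

lemma deriv_Y_closed: 
  assumes "N \<in> Z"
  shows "deriv_Y r N \<in> Z"
  unfolding deriv_Y_def
  using assms by (intro Z_sum Z_single) (auto simp: Z_iff laurent_C_simps(1) \<theta>_mult \<theta>_of_int)

text \<open>Separability is stated through a generated ideal. Its minimality, tested against the sum
  of the two principal ideals, produces explicit coefficients.\<close>

lemma separable_bezout:
  assumes N: "N \<in> Z" and sep: "separable_Z \<theta> r N"
  obtains U V where "U \<in> Z" "V \<in> Z" "U * N + V * deriv_Y r N = 1"
proof -
  interpret cring "laurent_Z \<theta> r" by (rule cring_Z)
  let ?P = "\<lambda>a. PIdl\<^bsub>laurent_Z \<theta> r\<^esub> a" and ?D = "deriv_Y r N"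
  have D: "?D \<in> Z" by (rule deriv_Y_closed[OF N])
  have ideal: "ideal (?P N <+>\<^bsub>laurent_Z \<theta> r\<^esub> ?P ?D) (laurent_Z \<theta> r)"
    using N D by (intro add_ideals cgenideal_ideal)
  have mem: "a + b \<in> ?P N <+>\<^bsub>laurent_Z \<theta> r\<^esub> ?P ?D" if "a \<in> ?P N" "b \<in> ?P ?D" for a b
    using that by (auto simp: set_add_def' laurent_Z_simps)
  have zero: "0 \<in> ?P N" "0 \<in> ?P ?D"
    using N D Z_0 by (auto simp: cgenideal_def laurent_Z_simps intro!: exI[of _ 0])
  have "{N, ?D} \<subseteq> ?P N <+>\<^bsub>laurent_Z \<theta> r\<^esub> ?P ?D"
    using mem[of N 0] mem[of 0 ?D] zero cgenideal_self N D by auto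
  from genideal_minimal[OF ideal this] have "1 \<in> ?P N <+>\<^bsub>laurent_Z \<theta> r\<^esub> ?P ?D"
    using sep Z_1 by (auto simp: separable_Z_def)
  then obtain U V where "U \<in> Z" "V \<in> Z" "1 = U \<star> N + V \<star> ?D"
    by (auto simp: set_add_def' cgenideal_def laurent_Z_simps)
  then show thesis using that[of U V] by (simp add: Z_left)
qed

end


unbundle fps_syntax

context finite_order_automorphism
begin

subsection \<open>An element of trace one\<close>

lemma funpow_add: "(\<theta> ^^ k) (a + b) = (\<theta> ^^ k) a + (\<theta> ^^ k) b"
  and funpow_mult: "(\<theta> ^^ k) (a * b) = (\<theta> ^^ k) a * (\<theta> ^^ k) b"
  using pow_add[of "int k"] pow_mult[of "int k"] by (simp_all add: int_funpow_of_nat)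

lemma funpow_distinct:
  assumes "k < n" "n < r"
  obtains y where "(\<theta> ^^ k) y \<noteq> (\<theta> ^^ n) y"
proof -
  have "\<theta> ^^ (n - k) \<noteq> id" using order assms by (simp add: has_order_def)
  then obtain y where "(\<theta> ^^ (n - k)) y \<noteq> y" by (auto simp: fun_eq_iff)
  then have "(\<theta> ^^ k) ((\<theta> ^^ (n - k)) y) \<noteq> (\<theta> ^^ k) y"
    using bij bij_is_inj[OF bij_fn[OF bij, of k]] by (simp add: inj_eq)
  moreover have "(\<theta> ^^ k) ((\<theta> ^^ (n - k)) y) = (\<theta> ^^ n) y"
    using assms Nat.funpow_add[of k "n - k" \<theta>] by simp
  ultimately show thesis using that by metis
qed

text \<open>Artin's argument: \<theta>^n(y) times the relation at x, minus the relation at y x, has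
  no n-th term. Choosing y with \<theta>^k(y) different from \<theta>^n(y) keeps a nonzero factor in
  front of c k.\<close>

lemma funpow_independent:
  assumes "n \<le> r" "\<And>x. (\<Sum>k<n. c k * (\<theta> ^^ k) x) = 0" "k < n"
  shows "c k = 0"
  using assms
proof (induction n arbitrary: c k)
  case (Suc n)
  have zero: "c k = 0" if kn: "k < n" for k
  proof -
    obtain y where y: "(\<theta> ^^ k) y \<noteq> (\<theta> ^^ n) y"
      using funpow_distinct[OF kn] Suc.prems(1) by auto
    have "(\<Sum>k<n. (c k * ((\<theta> ^^ n) y - (\<theta> ^^ k) y)) * (\<theta> ^^ k) x) = 0" for x
    proof -
      have "(\<Sum>k<n. (c k * ((\<theta> ^^ n) y - (\<theta> ^^ k) y)) * (\<theta> ^^ k) x) =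
          (\<theta> ^^ n) y * (\<Sum>k<Suc n. c k * (\<theta> ^^ k) x) - (\<Sum>k<Suc n. c k * (\<theta> ^^ k) (y * x))"
        by (simp add: funpow_mult sum_distrib_left sum_subtractf algebra_simps)
      then show ?thesis by (simp only: Suc.prems(2)) simp
    qed
    then have "c k * ((\<theta> ^^ n) y - (\<theta> ^^ k) y) = 0"
      using Suc.IH[of "\<lambda>k. c k * ((\<theta> ^^ n) y - (\<theta> ^^ k) y)" k] Suc.prems(1) that by simp
    then show ?thesis using y by simp
  qed
  \<comment> \<open>At x = 1 the terms below n are already zero and the last one is c n.\<close>
  have "c n = 0"
    using Suc.prems(2)[of 1] zero pow_1[of "int n"] by (simp add: int_funpow_of_nat)
  then show ?case using zero Suc.prems(3) less_Suc_eq by auto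
qed simp

text \<open>Independence provides some x with nonzero trace t. As t is fixed by \<theta>, the trace
  is linear for multiplication by its inverse, and x/t has trace 1.\<close>

lemma exists_trace_1: "\<exists>b. (\<Sum>k<r. (\<theta> ^^ k) b) = 1"
proof -
  obtain x where x: "(\<Sum>k<r. (\<theta> ^^ k) x) \<noteq> 0"
    using funpow_independent[of r "\<lambda>_. 1" 0] r_pos by auto
  define t where "t = (\<Sum>k<r. (\<theta> ^^ k) x)"
  have t: "t \<noteq> 0" using x by (simp add: t_def)
  \<comment> \<open>\<theta> shifts the sum by one index, and the new last term \<theta>^r(x) is x
    again.\<close>
  have "\<theta> t + x = (\<Sum>k<Suc r. (\<theta> ^^ k) x)"
    using pow_sum[of 1 "\<lambda>k. (\<theta> ^^ k) x" "{..<r}"]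
    unfolding t_def sum.lessThan_Suc_shift by (simp add: add.commute)
  also have "\<dots> = t + x" using order by (simp add: t_def has_order_def)
  finally have "\<theta> t = t" by simp
  then have "t * \<theta> (inverse t) = t * inverse t"
    using \<theta>_mult[of t "inverse t"] t by (simp add: \<theta>_1)
  then have "\<theta> (inverse t) = inverse t" using t by (simp only: mult_cancel_left) simp
  then have "(\<theta> ^^ k) (inverse t) = inverse t" for k
    using pow_fixed[of "inverse t" "int k"] by (simp add: int_funpow_of_nat)
  then have "(\<Sum>k<r. (\<theta> ^^ k) (x * inverse t)) = t * inverse t"
    by (simp add: funpow_mult t_def flip: sum_distrib_right)
  then show ?thesis using t by auto
qed


subsection \<open>A cocycle with values in power series\<close>

definition twist :: "int \<Rightarrow> 'k fps \<Rightarrow> 'k fps" where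
  "twist i F = Abs_fps (\<lambda>n. pow i (F $ n))"

lemma twist_nth [simp]: "twist i F $ n = pow i (F $ n)"
  by (simp add: twist_def)

lemma twist_mult: "twist i (F * G) = twist i F * twist i G"
  by (rule fps_ext) (simp add: fps_mult_nth pow_sum pow_mult)

lemma twist_1 [simp]: "twist i 1 = 1"
  by (rule fps_ext) simp

lemma twist_0 [simp]: "twist 0 F = F"
  by (rule fps_ext) simp

lemma twist_add: "twist (i + j) F = twist i (twist j F)"
  by (rule fps_ext) (simp add: int_funpow_add[OF bij])

definition unit_series :: "'k \<Rightarrow> 'k fps" where
  "unit_series b = 1 + fps_const b * fps_X"

lemma unit_series_inverse: "inverse (unit_series b) * unit_series b = 1"
  by (rule inverse_mult_eq_1) (simp add: unit_series_def)

lemma unit_series_cancel: "unit_series b * F = unit_series b * G \<longleftrightarrow> F = G"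
  using unit_series_inverse[of b] by auto

text \<open>
  The values are those of a multiplicative cocycle because \<open>F \<mapsto> (1 + b T) \<theta>(F)\<close> is a
  \<open>\<theta>\<close>-semilinear bijection.
\<close>

definition cocycle :: "'k \<Rightarrow> int \<Rightarrow> 'k fps" where
  "cocycle b i = int_funpow (\<lambda>F. unit_series b * twist 1 F) i 1"

lemma bij_unit_twist: "bij (\<lambda>F. unit_series b * twist 1 F)"
proof (rule o_bij)
  have c: "inverse (unit_series b) * (unit_series b * F) = F"
    "unit_series b * (inverse (unit_series b) * F) = F" for F
    using unit_series_inverse[of b] by (metis mult.assoc mult.commute mult_1)+
  show "(\<lambda>F. twist (- 1) (inverse (unit_series b) * F)) \<circ> (\<lambda>F. unit_series b * twist 1 F) = id"
    "(\<lambda>F. unit_series b * twist 1 F) \<circ> (\<lambda>F. twist (- 1) (inverse (unit_series b) * F)) = id"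
    by (simp_all add: fun_eq_iff c flip: twist_add)
qed

text \<open>The i-th iterate is \<theta>^i-semilinear, hence determined by its value at 1. Applied
  to \<open>cocycle b j\<close> this gives the cocycle identity, for negative exponents as
  well.\<close>

lemma unit_twist_pow:
  "int_funpow (\<lambda>F. unit_series b * twist 1 F) i F = cocycle b i * twist i F"
proof (induction i rule: int_induct[where k = 0])
  case base
  then show ?case by (simp add: cocycle_def)
next
  case (step1 i)
  have "twist (i + 1) F = twist 1 (twist i F)" using twist_add[of 1 i F] by (simp add: add.commute)
  then show ?case
    using step1.IH by (simp add: cocycle_def int_funpow_succ[OF bij_unit_twist] twist_mult mult.assoc)
next
  case (step2 i)
  let ?M = "\<lambda>F. unit_series b * twist 1 F"
  have M: "?M (int_funpow ?M (i - 1) F) = int_funpow ?M i F" for F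
    using int_funpow_succ[OF bij_unit_twist, of b "i - 1" F] by simp
  have "twist i F = twist 1 (twist (i - 1) F)" using twist_add[of 1 "i - 1" F] by simp
  then have "?M (cocycle b (i - 1) * twist (i - 1) F) = ?M (int_funpow ?M (i - 1) F)"
    using step2.IH M[of 1] M[of F] by (simp add: cocycle_def twist_mult flip: mult.assoc)
  then show ?case using bij_is_inj[OF bij_unit_twist, of b] by (metis injD)
qed

lemma cocycle_add: "cocycle b (i + j) = cocycle b i * twist i (cocycle b j)"
  using unit_twist_pow[of b i "cocycle b j"] by (simp add: cocycle_def int_funpow_add[OF bij_unit_twist])

lemma cocycle_0 [simp]: "cocycle b 0 = 1" and cocycle_1: "cocycle b 1 = unit_series b"
  by (simp_all add: cocycle_def)

text \<open>Evaluate the cocycle at 1 + i in both orders: \<theta>^i acts trivially, and cancelling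
  \<open>unit_series b\<close> leaves invariance under \<theta>. This is what makes the deformation
  preserve Z.\<close>

lemma cocycle_fixed:
  assumes "int r dvd i"
  shows "\<theta> (cocycle b i $ n) = cocycle b i $ n"
proof -
  have "twist i F = F" for F
    using assms by (intro fps_ext) (simp add: pow_dvd)
  then have "unit_series b * twist 1 (cocycle b i) = unit_series b * cocycle b i"
    using cocycle_add[of b 1 i] cocycle_add[of b i 1] by (simp add: cocycle_1 add.commute mult.commute)
  then have "twist 1 (cocycle b i) = cocycle b i" by (simp only: unit_series_cancel)
  from arg_cong[OF this, of "\<lambda>F. F $ n"] show ?thesis by simp
qed

text \<open>Makes the deformation the identity modulo T.\<close>

lemma cocycle_nth_0 [simp]: "cocycle b i $ 0 = 1"
proof (induction i rule: int_induct[where k = 0])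
  case (step1 i)
  then show ?case using cocycle_add[of b 1 i]
    by (simp add: cocycle_1 unit_series_def add.commute \<theta>_1)
next
  case (step2 i)
  have "\<theta> (cocycle b (i - 1) $ 0) = 1"
    using step2 cocycle_add[of b 1 "i - 1"] by (simp add: cocycle_1 unit_series_def)
  then show ?case using \<theta>_eq_iff[of _ 1] by (simp add: \<theta>_1)
qed simp

lemma cocycle_nth_1_add: "cocycle b (i + j) $ 1 = cocycle b i $ 1 + pow i (cocycle b j $ 1)"
  by (simp add: cocycle_add fps_mult_nth)

lemma cocycle_nth_1_of_nat: "cocycle b (int n) $ 1 = (\<Sum>k<n. (\<theta> ^^ k) b)"
proof (induction n)
  case (Suc n)
  have "cocycle b (int (Suc n)) $ 1 = b + \<theta> (cocycle b (int n) $ 1)"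
    using cocycle_nth_1_add[of b 1 "int n"] by (simp add: cocycle_1 unit_series_def add.commute)
  also have "\<dots> = (\<Sum>k<Suc n. (\<theta> ^^ k) b)"
    using pow_sum[of 1 "\<lambda>k. (\<theta> ^^ k) b" "{..<n}"] unfolding Suc sum.lessThan_Suc_shift by simp
  finally show ?case .
qed simp

text \<open>First-order coefficients form an additive cocycle, which is additive in the ordinary
  sense on multiples of r. Its value at r is the trace of b, so trace 1 yields exactly the exponent
  of Y.\<close>

lemma cocycle_nth_1_dvd:
  assumes "(\<Sum>k<r. (\<theta> ^^ k) b) = 1" "int r dvd i"
  shows "cocycle b i $ 1 = of_int (i div int r)"
  using assms(2)
proof (induction i rule: dvd_int_induct)
  case (add i)
  then show ?case
    using cocycle_nth_1_add[of b i "int r"] assms(1) r_pos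
    by (simp add: cocycle_nth_1_of_nat[of b r, simplified])
next
  case (diff i)
  have "cocycle b i $ 1 = cocycle b (i - int r) $ 1 + 1"
    using cocycle_nth_1_add[of b "i - int r" "int r"] assms(1) cocycle_nth_1_of_nat[of b r] by simp
  moreover have "(i - int r) div int r = i div int r - 1"
    using diff(1) r_pos div_mult_self1[of "int r" i "- 1"] by simp
  ultimately show ?case using diff by (simp add: eq_diff_eq)
qed simp


subsection \<open>The deformation of the identity\<close>

text \<open>
  The homomorphism to power series that fixes \<open>K\<close> and sends \<open>X\<close> to \<open>(1 + b T) X\<close>.
\<close>

definition deform :: "'k \<Rightarrow> (int \<Rightarrow>\<^sub>0 'k) \<Rightarrow> (int \<Rightarrow>\<^sub>0 'k) fps" where
  "deform b f = Abs_fps (\<lambda>n. Poly_Mapping.mapp (\<lambda>i c. c * cocycle b i $ n) f)"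

text \<open>The product of A[[T]]. The product \<open>*\<close> of the same type is reserved for
  series with coefficients in Z acting on it.\<close>

definition skew_prod :: "(int \<Rightarrow>\<^sub>0 'k) fps \<Rightarrow> (int \<Rightarrow>\<^sub>0 'k) fps \<Rightarrow> (int \<Rightarrow>\<^sub>0 'k) fps" where
  "skew_prod F G = Abs_fps (\<lambda>n. \<Sum>i=0..n. F $ i \<star> G $ (n - i))"

lemma lookup_deform [simp]:
  "Poly_Mapping.lookup (deform b f $ n) i = Poly_Mapping.lookup f i * cocycle b i $ n"
  by (simp add: deform_def lookup_mapp when_def in_keys_iff)

lemma deform_add: "deform b (f + g) = deform b f + deform b g"
  by (intro fps_ext poly_mapping_eqI) (simp add: lookup_add distrib_right)

lemma deform_0 [simp]: "deform b 0 = 0"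
  by (intro fps_ext poly_mapping_eqI) simp

lemma deform_single:
  "deform b (Poly_Mapping.single i c) $ n = Poly_Mapping.single i (c * cocycle b i $ n)"
  by (intro poly_mapping_eqI) (simp add: lookup_single when_def)

lemma deform_const: "deform b (Poly_Mapping.single 0 c) = fps_const (Poly_Mapping.single 0 c)"
  by (intro fps_ext poly_mapping_eqI) (simp add: lookup_single when_def)

lemma deform_nth_0 [simp]: "deform b f $ 0 = f"
  by (intro poly_mapping_eqI) simp

lemma single_sum: "Poly_Mapping.single i (sum f A) = (\<Sum>a\<in>A. Poly_Mapping.single i (f a))"
  by (induction A rule: infinite_finite_induct) (simp_all add: single_add)

lemma skew_prod_add: "skew_prod (F + F') G = skew_prod F G + skew_prod F' G"
  "skew_prod F (G + G') = skew_prod F G + skew_prod F G'"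
  by (simp_all add: fps_eq_iff skew_prod_def skew_mult_add_left skew_mult_add_right sum.distrib)

lemma skew_prod_0 [simp]: "skew_prod 0 G = 0" "skew_prod F 0 = 0"
  by (simp_all add: fps_eq_iff skew_prod_def)

text \<open>On monomials this is the cocycle identity; both sides are biadditive.\<close>

lemma deform_mult: "deform b (f \<star> g) = skew_prod (deform b f) (deform b g)"
proof (induction f rule: any_single_induct)
  case (add i c f)
  have "deform b (Poly_Mapping.single i c \<star> g) = skew_prod (deform b (Poly_Mapping.single i c)) (deform b g)"
  proof (induction g rule: any_single_induct)
    case (add j a g)
    have "deform b (Poly_Mapping.single (i + j) (c * pow i a)) $ n =
        skew_prod (deform b (Poly_Mapping.single i c)) (deform b (Poly_Mapping.single j a)) $ n" for n
      by (simp add: deform_single skew_prod_def skew_mult_single cocycle_add fps_mult_nth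
          pow_mult sum_distrib_left ac_simps flip: single_sum)
    then have "deform b (Poly_Mapping.single i c \<star> Poly_Mapping.single j a) =
        skew_prod (deform b (Poly_Mapping.single i c)) (deform b (Poly_Mapping.single j a))"
      unfolding skew_mult_single by (intro fps_ext)
    then show ?case by (simp add: add skew_mult_add_right deform_add skew_prod_add)
  qed simp
  then show ?case by (simp add: add skew_mult_add_left deform_add skew_prod_add)
qed simp

lemma deform_closed: "f \<in> S d \<Longrightarrow> deform b f $ n \<in> S d"
  by (simp add: S_iff)

lemma deform_Z: "f \<in> Z \<Longrightarrow> deform b f $ n \<in> Z"
  using cocycle_fixed
  by (auto simp: Z_iff deform_closed \<theta>_mult) (metis S_iff \<theta>_0 mult_zero_left)

text \<open>The monomial in front is Y. It restores the exponents that \<open>deriv_Y\<close> lowers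
  by r.\<close>

lemma deform_nth_1:
  assumes "(\<Sum>k<r. (\<theta> ^^ k) b) = 1" "f \<in> Z"
  shows "deform b f $ 1 = Poly_Mapping.single (int r) 1 * deriv_Y r f"
proof -
  have "Poly_Mapping.single (int r) 1 * deriv_Y r f =
      (\<Sum>i\<in>Poly_Mapping.keys f. Poly_Mapping.single i (Poly_Mapping.lookup f i * cocycle b i $ 1))"
    unfolding deriv_Y_def sum_distrib_left mult_single
    using assms by (intro sum.cong refl arg_cong2[of _ _ _ _ Poly_Mapping.single])
      (auto simp: Z_iff laurent_C_simps(1) cocycle_nth_1_dvd simp del: One_nat_def)
  also have "\<dots> = deform b f $ 1"
    by (intro poly_mapping_eqI) (simp add: lookup_sum lookup_single when_def in_keys_iff)
  finally show ?thesis by simp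
qed


end

subsection \<open>Expansion in powers of another uniformizer\<close>

text \<open>
  If \<open>H\<close> is inverse to \<open>h\<close>, then \<open>F = F\<^sub>0 + T h (H (F - F\<^sub>0) / T)\<close>; iterating this, the digits
  of \<open>F\<close> are the coefficients of its expansion in powers of \<open>T h\<close>.
\<close>

primrec digit :: "'c::comm_ring_1 fps \<Rightarrow> nat \<Rightarrow> 'c fps \<Rightarrow> 'c" where
  "digit H 0 F = F $ 0"
| "digit H (Suc n) F = digit H n (H * fps_shift 1 F)"


lemma fps_shift_const_mult:
  "fps_shift k (fps_const c * (F :: 'c::comm_ring_1 fps)) = fps_const c * fps_shift k F"
  by (simp add: fps_eq_iff)

lemma digit_add: "digit H n (F + G) = digit H n F + digit H n G"
  by (induction n arbitrary: F G) (simp_all add: fps_shift_add distrib_left)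

lemma digit_const_mult: "digit H n (fps_const c * F) = c * digit H n F"
  by (induction n arbitrary: F) (simp_all add: fps_shift_const_mult mult.left_commute[of H])

lemma digit_0 [simp]: "digit H n 0 = 0"
  using digit_const_mult[of H n 0 0] by simp

lemma digit_const: "digit H n (fps_const c) = (if n = 0 then c else 0)"
proof (cases n)
  case (Suc m)
  have "fps_shift 1 (fps_const c) = 0" by (simp add: fps_eq_iff)
  then show ?thesis using Suc by simp
qed simp

context finite_order_automorphism
begin

lemma digit_closed:
  assumes "d dvd r" "\<And>n. H $ n \<in> Z" "\<And>n. F $ n \<in> S d"
  shows "digit H n F \<in> S d"
  using assms(3)
proof (induction n arbitrary: F)
  case (Suc n)
  have "(H * fps_shift 1 F) $ m \<in> S d" for m
    unfolding fps_mult_nth using assms Suc.prems by (intro S_sum S_Z_mult) auto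
  then show ?case by (simp add: Suc.IH)
qed simp

text \<open>Left multiplication by a constant of A that need not be central, so that
  \<open>fps_const\<close> with \<open>*\<close> would give a different result.\<close>

definition skew_scale :: "(int \<Rightarrow>\<^sub>0 'k) \<Rightarrow> (int \<Rightarrow>\<^sub>0 'k) fps \<Rightarrow> (int \<Rightarrow>\<^sub>0 'k) fps" where
  "skew_scale f G = Abs_fps (\<lambda>n. f \<star> G $ n)"

lemma mult_skew_scale:
  assumes "\<And>n. H $ n \<in> Z"
  shows "H * skew_scale f G = skew_scale f (H * G)"
  using assms by (simp add: fps_eq_iff skew_scale_def fps_mult_nth skew_mult_sum_right skew_mult_Z_right)

lemma mult_skew_prod:
  assumes "\<And>n. H $ n \<in> Z"
  shows "H * skew_prod F G = skew_prod (H * F) G"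
proof (rule fps_ext)
  fix n
  have "(H * skew_prod F G) $ n = (\<Sum>j=0..n. \<Sum>i=0..n-j. H $ j * (F $ i \<star> G $ (n - j - i)))"
    by (simp add: fps_mult_nth skew_prod_def sum_distrib_left)
  also have "\<dots> = (\<Sum>j=0..n. \<Sum>i=0..j. H $ i * (F $ (j - i) \<star> G $ (n - j)))"
    by (rule fps_mult_assoc_lemma[symmetric])
  also have "\<dots> = skew_prod (H * F) G $ n"
    using assms by (simp add: skew_prod_def fps_mult_nth skew_mult_sum_left skew_mult_Z_left)
  finally show "(H * skew_prod F G) $ n = skew_prod (H * F) G $ n" .
qed

text \<open>A one-sided Leibniz rule for F \<mapsto> (F - F(0))/T, from writing FG - F(0)G(0) as
  F(0)(G - G(0)) + (F - F(0))G.\<close>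

lemma shift_skew_prod:
  "fps_shift 1 (skew_prod F G) = skew_scale (F $ 0) (fps_shift 1 G) + skew_prod (fps_shift 1 F) G"
proof (rule fps_ext)
  fix n
  have "(\<Sum>i=0..Suc n. F $ i \<star> G $ (Suc n - i)) =
      F $ 0 \<star> G $ Suc n + (\<Sum>i=0..n. F $ Suc i \<star> G $ (n - i))"
    by (subst sum.atLeast0_atMost_Suc_shift) simp
  then show "fps_shift 1 (skew_prod F G) $ n =
      (skew_scale (F $ 0) (fps_shift 1 G) + skew_prod (fps_shift 1 F) G) $ n"
    by (simp add: skew_prod_def skew_scale_def)
qed

lemma digit_skew_scale:
  assumes "\<And>n. H $ n \<in> Z"
  shows "digit H n (skew_scale f G) = f \<star> digit H n G"
proof (induction n arbitrary: G)
  case 0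
  then show ?case by (simp add: skew_scale_def)
next
  case (Suc n)
  have "fps_shift 1 (skew_scale f G) = skew_scale f (fps_shift 1 G)"
    by (simp add: fps_eq_iff skew_scale_def)
  then show ?case using Suc.IH by (simp add: mult_skew_scale[OF assms])
qed

text \<open>Since H is central, F \<mapsto> H (F - F(0))/T obeys the same one-sided Leibniz rule as
  the shift, and iterating that rule produces the convolution. The identity is exact in A, before
  any reduction modulo N.\<close>

lemma digit_skew_prod:
  assumes "\<And>n. H $ n \<in> Z"
  shows "digit H n (skew_prod F G) = (\<Sum>i\<le>n. digit H i F \<star> digit H (n - i) G)"
proof (induction n arbitrary: F G)
  case 0
  then show ?case by (simp add: skew_prod_def)
next
  case (Suc n)
  let ?L = "\<lambda>F. H * fps_shift 1 F"
  have "digit H (Suc n) (skew_prod F G) =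
      digit H n (skew_scale (F $ 0) (?L G)) + digit H n (skew_prod (?L F) G)"
    by (simp add: shift_skew_prod distrib_left mult_skew_scale[OF assms]
        mult_skew_prod[OF assms] digit_add del: One_nat_def)
  also have "\<dots> = F $ 0 \<star> digit H (Suc n) G + (\<Sum>i\<le>n. digit H (Suc i) F \<star> digit H (n - i) G)"
    by (simp add: digit_skew_scale[OF assms] Suc.IH)
  also have "\<dots> = (\<Sum>i\<le>Suc n. digit H i F \<star> digit H (Suc n - i) G)"
    by (subst sum.atMost_Suc_shift) simp
  finally show ?case .
qed

text \<open>Laurent polynomials do not form a field, so the inverse is
  \<open>fps_right_inverse\<close> with constant term 1. Its coefficients are obtained recursively
  from those of s by sums and products, which stay in Z.\<close>

lemma Z_right_inverse:
  assumes "s $ 0 = 1" "\<And>n. s $ n \<in> Z"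
  obtains I where "s * I = 1" "\<And>n. I $ n \<in> Z"
proof -
  define I where "I = fps_right_inverse s 1"
  have sI: "s * I = 1" unfolding I_def using assms by (intro fps_right_inverse) simp
  have "I $ n \<in> Z" for n
  proof (induction n rule: less_induct)
    case (less n)
    have "(s * I) $ n = I $ n + (\<Sum>i=1..n. s $ i * I $ (n - i))"
      using assms(1) by (simp add: fps_mult_nth sum.atLeast_Suc_atMost)
    then have "I $ n = (1 :: (int \<Rightarrow>\<^sub>0 'k) fps) $ n + - (\<Sum>i=1..n. s $ i * I $ (n - i))"
      using sI by (simp add: algebra_simps)
    also have "\<dots> \<in> Z"
      using less assms by (intro Z_add Z_uminus Z_sum Z_mult) (auto simp: Z_0 Z_1)
    finally show ?case .
  qed
  then show thesis using sI that by blast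
qed

text \<open>Here h, the deformed N minus N, divided by T, has constant term Y dN/dY. With V' = V/Y,
  the constant term of V' h is V dN/dY = 1 - U N. Adding U N gives a series s with constant term
  exactly 1, invertible over Z. Then H = V'/s inverts h up to a multiple of N, which is recorded by
  W.\<close>

lemma inverse_mod:
  assumes N: "N \<in> Z" and sep: "separable_Z \<theta> r N" and tr: "(\<Sum>k<r. (\<theta> ^^ k) b) = 1"
  obtains H W where "\<And>n. H $ n \<in> Z" "\<And>n. W $ n \<in> Z"
    "H * fps_shift 1 (deform b N) = 1 - fps_const N * W"
proof -
  obtain U V where UV: "U \<in> Z" "V \<in> Z" "U * N + V * deriv_Y r N = 1"
    using separable_bezout[OF N sep] .
  define V' where "V' = V * Poly_Mapping.single (- int r) 1"
  have V': "V' \<in> Z" unfolding V'_def using UV by (intro Z_mult Z_single) (simp_all add: \<theta>_1)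
  define h where "h = fps_shift 1 (deform b N)"
  have h: "h $ n \<in> Z" for n by (simp add: h_def deform_Z[OF N])
  have "V' * h $ 0 = V * (Poly_Mapping.single (- int r) 1 * Poly_Mapping.single (int r) 1) * deriv_Y r N"
    using deform_nth_1[OF tr N] by (simp add: h_def V'_def ac_simps)
  also have "\<dots> = V * deriv_Y r N" by (simp add: mult_single)
  finally have Vh: "V' * h $ 0 = V * deriv_Y r N" .
  define s where "s = fps_const V' * h + fps_const (U * N)"
  have "s $ 0 = 1" using UV by (simp add: s_def Vh add.commute)
  moreover have "s $ n \<in> Z" for n
    unfolding s_def using UV V' h N by (auto intro!: Z_add Z_mult Z_0)
  ultimately obtain I where I: "s * I = 1" "\<And>n. I $ n \<in> Z" using Z_right_inverse by blast
  show thesis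
  proof
    show "(fps_const V' * I) $ n \<in> Z" "(fps_const U * I) $ n \<in> Z" for n
      using V' UV I by (simp_all add: Z_mult)
    have "fps_const V' * I * h = (s - fps_const (U * N)) * I" by (simp add: s_def ac_simps)
    also have "\<dots> = s * I - fps_const N * (fps_const U * I)"
      by (simp only: left_diff_distrib right_diff_distrib fps_const_mult[symmetric] ac_simps)
    also have "s * I = 1" by (rule I)
    finally show "fps_const V' * I * fps_shift 1 (deform b N) = 1 - fps_const N * (fps_const U * I)"
      by (simp add: h_def)
  qed
qed


section \<open>Existence of the isomorphism for A and C at once\<close>

lemma finsum_S: 
  assumes "finite A" "\<And>i. i \<in> A \<Longrightarrow> g i \<in> S d"
  shows "(\<Oplus>\<^bsub>laurent_C \<theta> d\<^esub>i\<in>A. g i) = sum g A"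
  using assms
proof (induction A rule: finite_induct)
  case empty
  interpret ring "laurent_C \<theta> d" by (rule ring_S)
  show ?case by (simp add: laurent_C_simps)
next
  case (insert x F)
  interpret ring "laurent_C \<theta> d" by (rule ring_S)
  show ?case using insert by (simp add: finsum_insert Pi_def laurent_C_simps(3))
qed

lemma laurent_const_closed: "laurent_const a \<in> S d"
  by (simp add: laurent_const_def S_single)

text \<open>The digits \<open>D n f\<close> already satisfy the product rule of power series inside
  the ring itself. Reduction modulo N is applied last, and it is there that N becomes T;
  \<open>ring_iso_extending\<close> then takes over.\<close>

lemma exists_tau:
  assumes d: "d dvd r" and N: "N \<in> Z" and sep: "separable_Z \<theta> r N"
  shows "\<exists>\<tau>. is_tau (laurent_C \<theta> d) N \<tau>"
proof -
  let ?R = "laurent_C \<theta> d"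
  interpret R: central_element ?R N by (rule central[OF d N])
  obtain b where b: "(\<Sum>k<r. (\<theta> ^^ k) b) = 1" using exists_trace_1 by blast
  obtain H W where H: "\<And>n. H $ n \<in> Z" and W: "\<And>n. W $ n \<in> Z"
    and HW: "H * fps_shift 1 (deform b N) = 1 - fps_const N * W"
    using inverse_mod[OF N sep b] by blast
  define D where "D n f = digit H n (deform b f)" for n f
  have D_closed: "D n f \<in> S d" if "f \<in> S d" for n f
    unfolding D_def using d H deform_closed[OF that] by (rule digit_closed)
  have D_mult: "D n (f \<star> g) = (\<Sum>i\<le>n. D i f \<star> D (n - i) g)" for n f g
    by (simp add: D_def deform_mult digit_skew_prod[OF H])
  have D_const: "D n (Poly_Mapping.single 0 c) = (if n = 0 then Poly_Mapping.single 0 c else 0)" for n c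
    by (simp add: D_def deform_const digit_const)
  \<comment> \<open>The first step of the recursion replaces the deformed N by H h = 1 - N W, so the
    digits of N from index 1 on are those of the constant 1, up to multiples of N. Digit 0 is N
    itself.\<close>
  have D_Suc_N: "D (Suc n) N = (if n = 0 then 1 else 0) + N \<star> - digit H n W" for n
  proof -
    have eq: "H * fps_shift 1 (deform b N) = fps_const 1 + fps_const N * - W"
      by (simp add: HW del: One_nat_def)
    have "digit H n (- W) = - digit H n W"
      using digit_const_mult[of H n "- 1" W] by (simp add: fps_const_neg flip: fps_const_neg)
    then show ?thesis
      unfolding D_def digit.simps eq digit_add digit_const digit_const_mult using N by (simp add: Z_left)
  qed
  define p where "p f = multiples ?R N +>\<^bsub>?R\<^esub> f" for f
  have p_closed: "p f \<in> carrier R.Q" if "f \<in> S d" for f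
    using that by (auto simp: p_def R.one.carrier_quot)
  have p_add: "p (f + g) = p f \<oplus>\<^bsub>R.Q\<^esub> p g" and p_mult: "p (f \<star> g) = p f \<otimes>\<^bsub>R.Q\<^esub> p g"
    if "f \<in> S d" "g \<in> S d" for f g
    using R.Q_simps[OF that] by (simp_all add: p_def laurent_C_simps(2,3))
  have p_N: "p (N \<star> g) = \<zero>\<^bsub>R.Q\<^esub>" if "g \<in> S d" for g
    using R.a_rcos_zero[OF R.one.is_ideal multiplesI[of g ?R "N \<star> g" N]] that
    by (simp add: p_def FactRing_def laurent_C_simps(2))
  have p_0: "p 0 = \<zero>\<^bsub>R.Q\<^esub>" using p_N[OF S_0] by simp
  have p_1: "p 1 = \<one>\<^bsub>R.Q\<^esub>" by (simp add: p_def FactRing_def laurent_C_simps(4))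
  have D_const': "p (D n (Poly_Mapping.single 0 c)) =
      (if n = 0 then p (Poly_Mapping.single 0 c) else \<zero>\<^bsub>R.Q\<^esub>)" for n c
    by (simp add: D_const p_0)
  have hom: "(\<lambda>f n. p (D n f)) \<in> ring_hom ?R (quot_series ?R N)"
  proof (rule ring_hom_memI)
    fix f g assume f: "f \<in> S d" and g: "g \<in> S d"
    show "(\<lambda>n. p (D n f)) \<in> carrier (quot_series ?R N)"
      using f by (simp add: quot_series_def power_series_ring_def p_closed D_closed)
    have "p (D n (f \<star> g)) = (\<Oplus>\<^bsub>R.Q\<^esub>i\<in>{..n}. p (D i f) \<otimes>\<^bsub>R.Q\<^esub> p (D (n - i) g))" for n
    proof -
      have mem: "D i f \<star> D (n - i) g \<in> S d" for i using f g by (intro S_mult D_closed)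
      have "p (D n (f \<star> g)) = p (\<Oplus>\<^bsub>?R\<^esub>i\<in>{..n}. D i f \<star> D (n - i) g)"
        using mem by (simp add: D_mult finsum_S)
      also have "\<dots> = (\<Oplus>\<^bsub>R.Q\<^esub>i\<in>{..n}. p (D i f \<star> D (n - i) g))"
        unfolding p_def using mem
        by (subst ring_hom_ring.hom_finsum[OF R.one.rcos_ring_hom_ring]) (auto simp: comp_def)
      finally show ?thesis using f g by (simp add: p_mult D_closed)
    qed
    then show "(\<lambda>n. p (D n (f \<otimes>\<^bsub>?R\<^esub> g))) = (\<lambda>n. p (D n f)) \<otimes>\<^bsub>quot_series ?R N\<^esub> (\<lambda>n. p (D n g))"
      by (simp add: quot_series_def power_series_ring_def laurent_C_simps(2))
    show "(\<lambda>n. p (D n (f \<oplus>\<^bsub>?R\<^esub> g))) = (\<lambda>n. p (D n f)) \<oplus>\<^bsub>quot_series ?R N\<^esub> (\<lambda>n. p (D n g))"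
      using f g by (simp add: quot_series_def power_series_ring_def laurent_C_simps(3)
        D_def deform_add digit_add p_add D_closed[unfolded D_def])
  next
    show "(\<lambda>n. p (D n \<one>\<^bsub>?R\<^esub>)) = \<one>\<^bsub>quot_series ?R N\<^esub>"
      using D_const'[of _ 1] by (auto simp: fun_eq_iff quot_series_def power_series_ring_def
        laurent_C_simps(4) p_1)
  qed
  have N_T: "(\<lambda>n. p (D n N)) = series_T R.Q"
  proof
    fix n
    show "p (D n N) = series_T R.Q n"
    proof (cases n)
      case 0
      then show ?thesis using p_N[OF S_1] by (simp add: D_def series_T_def)
    next
      case (Suc m)
      have "digit H m W \<in> S d"
        using d H W by (intro digit_closed) (auto intro: Z_subset)
      then have "- digit H m W \<in> S d" by (rule S_uminus)
      then show ?thesis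
        using Suc R.N_carrier p_N[of "- digit H m W"]
        by (simp add: D_Suc_N p_add S_mult S_0 S_1 p_0 p_1 series_T_def)
    qed
  qed
  obtain \<tau> where \<tau>: "\<tau> \<in> ring_iso (adic_completion ?R N) (quot_series ?R N)"
    "\<And>a. a \<in> S d \<Longrightarrow> \<tau> (to_completion ?R N a) = (\<lambda>n. p (D n a))"
    "\<And>x. x \<in> carrier (adic_completion ?R N) \<Longrightarrow> \<tau> x 0 = x 1"
    using R.ring_iso_extending[OF hom N_T] by (auto simp: p_def D_def)
  have "is_tau ?R N \<tau>"
    using \<tau> R.N_carrier N_T D_const'
    by (auto simp: is_tau_def alg_iso_def laurent_const_closed series_const_def)
      (simp add: fun_eq_iff laurent_const_def p_def)
  then show ?thesis by blast
qed

end


subsection \<open>Ring homomorphisms to power series\<close>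

lemma power_series_ring_simps:
  "carrier (power_series_ring R) = {f. \<forall>n. f n \<in> carrier R}"
  "(f \<otimes>\<^bsub>power_series_ring R\<^esub> g) n = (\<Oplus>\<^bsub>R\<^esub>i\<in>{..n}. f i \<otimes>\<^bsub>R\<^esub> g (n - i))"
  "(f \<oplus>\<^bsub>power_series_ring R\<^esub> g) n = f n \<oplus>\<^bsub>R\<^esub> g n"
  "\<one>\<^bsub>power_series_ring R\<^esub> n = (if n = 0 then \<one>\<^bsub>R\<^esub> else \<zero>\<^bsub>R\<^esub>)"
  by (simp_all add: power_series_ring_def)

lemma power_series_ring_hom:
  assumes h: "h \<in> ring_hom R R'" and R: "ring R" and R': "ring R'"
  shows "(\<lambda>f n. h (f n)) \<in> ring_hom (power_series_ring R) (power_series_ring R')"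
proof (rule ring_hom_memI)
  interpret R: ring R by (rule R)
  fix f g assume f: "f \<in> carrier (power_series_ring R)" and g: "g \<in> carrier (power_series_ring R)"
  then have fg: "f n \<in> carrier R" "g n \<in> carrier R" for n by (simp_all add: power_series_ring_simps)
  show "(\<lambda>n. h (f n)) \<in> carrier (power_series_ring R')"
    using fg ring_hom_closed[OF h] by (simp add: power_series_ring_simps)
  show "(\<lambda>n. h ((f \<oplus>\<^bsub>power_series_ring R\<^esub> g) n)) =
      (\<lambda>n. h (f n)) \<oplus>\<^bsub>power_series_ring R'\<^esub> (\<lambda>n. h (g n))"
    using fg ring_hom_add[OF h] by (intro ext) (simp add: power_series_ring_simps)
  show "(\<lambda>n. h ((f \<otimes>\<^bsub>power_series_ring R\<^esub> g) n)) =
      (\<lambda>n. h (f n)) \<otimes>\<^bsub>power_series_ring R'\<^esub> (\<lambda>n. h (g n))"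
  proof
    fix n
    show "h ((f \<otimes>\<^bsub>power_series_ring R\<^esub> g) n) =
      ((\<lambda>n. h (f n)) \<otimes>\<^bsub>power_series_ring R'\<^esub> (\<lambda>n. h (g n))) n"
      using fg ring_hom_mult[OF h] by (simp add: power_series_ring_simps comp_def Pi_def
        ring_hom_ring.hom_finsum[OF ring_hom_ringI2[OF R R' h]])
  qed
next
  show "(\<lambda>n. h (\<one>\<^bsub>power_series_ring R\<^esub> n)) = \<one>\<^bsub>power_series_ring R'\<^esub>"
    using ring_hom_one[OF h] ring_hom_zero[OF h R R'] by (auto simp: power_series_ring_simps)
qed

lemma (in ring) finsum_split_ends:
  fixes m :: nat
  assumes "\<And>i. f i \<in> carrier R"
  shows "(\<Oplus>i\<in>{..Suc m}. f i) = f 0 \<oplus> (\<Oplus>i\<in>{1..m}. f i) \<oplus> f (Suc m)"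
proof -
  have "{..Suc m} = insert (Suc m) (insert 0 {1..m})" by auto
  then show ?thesis
    using assms a_comm by (simp add: finsum_insert Pi_def)
qed

text \<open>Used with \<open>m\<close> the middle part of a convolution, which two homomorphisms
  agreeing in lower degrees share.\<close>

lemma (in ring) leibniz_difference:
  assumes "a \<in> carrier R" "b \<in> carrier R" "m \<in> carrier R" "x \<in> carrier R" "x' \<in> carrier R"
    "y \<in> carrier R" "y' \<in> carrier R"
  shows "(a \<otimes> x \<oplus> m \<oplus> y \<otimes> b) \<ominus> (a \<otimes> x' \<oplus> m \<oplus> y' \<otimes> b) = a \<otimes> (x \<ominus> x') \<oplus> (y \<ominus> y') \<otimes> b"
  using assms by algebra

context central_element
begin

lemma to_completion_hom: "to_completion R N \<in> ring_hom R (adic_completion R N)"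
proof (rule ring_hom_memI)
  show "to_completion R N \<one> = \<one>\<^bsub>adic_completion R N\<^esub>"
    by (intro adic_eqI to_completion_closed adic_one_closed) (simp_all add: adic_one_eval to_completion_def)
qed (simp_all add: to_completion_closed to_completion_add to_completion_mult)

text \<open>N \<mapsto> T takes the place of a continuity assumption: for x = c + N y, coefficient n
  of the image of x is that of c plus coefficient n - 1 of the image of y, so induction on n works
  for all x at once. \<tau> supplies this decomposition.\<close>

lemma adic_hom_unique:
  assumes P: "ring P"
    and s: "s \<in> ring_hom (adic_completion R N) (power_series_ring P)"
      "s' \<in> ring_hom (adic_completion R N) (power_series_ring P)"
    and N: "s (to_completion R N N) = series_T P" "s' (to_completion R N N) = series_T P"
    and eq: "\<And>c. c \<in> carrier R \<Longrightarrow> s (to_completion R N c) = s' (to_completion R N c)"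
    and \<tau>: "\<tau> \<in> ring_iso (adic_completion R N) (quot_series R N)"
      "\<tau> (to_completion R N N) = series_T Q" "\<forall>x\<in>carrier (adic_completion R N). \<tau> x 0 = x 1"
    and x: "x \<in> carrier (adic_completion R N)"
  shows "s x = s' x"
proof
  interpret P: ring P by (rule P)
  have step: "h x n = h (to_completion R N c) n \<oplus>\<^bsub>P\<^esub> (if n = 0 then \<zero>\<^bsub>P\<^esub> else h y (n - 1))"
    if h: "h \<in> ring_hom (adic_completion R N) (power_series_ring P)"
      and hN: "h (to_completion R N N) = series_T P"
      and c: "c \<in> carrier R" and y: "y \<in> carrier (adic_completion R N)"
      and x: "x = to_completion R N c \<oplus>\<^bsub>adic_completion R N\<^esub>
           (to_completion R N N \<otimes>\<^bsub>adic_completion R N\<^esub> y)"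
    for h x c y n
    using ring_hom_add[OF h to_completion_closed[OF c]
        adic_mult_closed[OF to_completion_closed[OF N_carrier] y]]
      ring_hom_mult[OF h to_completion_closed[OF N_carrier] y] ring_hom_closed[OF h y]
    by (simp add: x hN P.series_T_mult power_series_ring_simps(3))
  fix n
  show "s x n = s' x n"
    using x
  proof (induction n arbitrary: x)
    case 0
    obtain c y where cy: "c \<in> carrier R" "y \<in> carrier (adic_completion R N)"
      "x = to_completion R N c \<oplus>\<^bsub>adic_completion R N\<^esub>
           (to_completion R N N \<otimes>\<^bsub>adic_completion R N\<^esub> y)"
      using adic_decomposition[OF \<tau> 0] .
    then show ?case using step[OF s(1) N(1) cy] step[OF s(2) N(2) cy] eq by simp
  next
    case (Suc n)
    obtain c y where cy: "c \<in> carrier R" "y \<in> carrier (adic_completion R N)"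
      "x = to_completion R N c \<oplus>\<^bsub>adic_completion R N\<^esub>
           (to_completion R N N \<otimes>\<^bsub>adic_completion R N\<^esub> y)"
      using adic_decomposition[OF \<tau> Suc.prems] .
    then show ?case using step[OF s(1) N(1) cy] step[OF s(2) N(2) cy] eq Suc.IH[OF cy(2)] by simp
  qed
qed

end

context finite_order_automorphism
begin

subsection \<open>Derivations of the commutative subring\<close>

lemma deriv_Y_expand:
  assumes "finite A" "Poly_Mapping.keys f \<subseteq> A"
  shows "deriv_Y r f = (\<Sum>i\<in>A. Poly_Mapping.single (i - int r)
           (of_int (i div int r) * Poly_Mapping.lookup f i))"
  unfolding deriv_Y_def using assms by (intro sum.mono_neutral_left) (auto simp: in_keys_iff)

lemma deriv_Y_add: "deriv_Y r (f + g :: int \<Rightarrow>\<^sub>0 'k) = deriv_Y r f + deriv_Y r g"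
proof -
  let ?A = "Poly_Mapping.keys f \<union> Poly_Mapping.keys g"
  have "Poly_Mapping.keys (f + g) \<subseteq> ?A" by (rule keys_add)
  then show ?thesis
    by (simp add: deriv_Y_expand[of ?A] lookup_add distrib_left single_add sum.distrib)
qed

lemma deriv_Y_single:
  "deriv_Y r (Poly_Mapping.single i c :: int \<Rightarrow>\<^sub>0 'k) =
    Poly_Mapping.single (i - int r) (of_int (i div int r) * c)"
  by (subst deriv_Y_expand[of "{i}"]) auto

lemma deriv_Y_S: "f \<in> S r \<Longrightarrow> deriv_Y r f \<in> S r"
  unfolding deriv_Y_def by (intro S_sum S_single) (auto simp: laurent_C_simps(1))

text \<open>The target may be noncommutative, so \<open>y\<close>, the value \<delta>(Y), stays to
  the right of all values of \<open>q\<close>. Centrality of the image of Y turns the Leibniz rule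
  into a recursion along the powers of Y.\<close>

lemma derivation_eq_0:
  fixes P :: "('b, 'm) ring_scheme" and q \<delta> :: "(int \<Rightarrow>\<^sub>0 'k) \<Rightarrow> 'b"
  assumes P: "ring P" and q: "q \<in> ring_hom (laurent_C \<theta> r) P"
    and q_central: "\<And>z. z \<in> carrier P \<Longrightarrow>
      q (Poly_Mapping.single (int r) 1) \<otimes>\<^bsub>P\<^esub> z = z \<otimes>\<^bsub>P\<^esub> q (Poly_Mapping.single (int r) 1)"
    and closed: "\<And>f. f \<in> S r \<Longrightarrow> \<delta> f \<in> carrier P"
    and add: "\<And>f g. f \<in> S r \<Longrightarrow> g \<in> S r \<Longrightarrow> \<delta> (f + g) = \<delta> f \<oplus>\<^bsub>P\<^esub> \<delta> g"
    and leibniz: "\<And>f g. f \<in> S r \<Longrightarrow> g \<in> S r \<Longrightarrow> \<delta> (f \<star> g) = q f \<otimes>\<^bsub>P\<^esub> \<delta> g \<oplus>\<^bsub>P\<^esub> \<delta> f \<otimes>\<^bsub>P\<^esub> q g"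
    and const: "\<And>c. \<delta> (laurent_const c) = \<zero>\<^bsub>P\<^esub>"
    and N: "N \<in> Z" "separable_Z \<theta> r N" "q N = \<zero>\<^bsub>P\<^esub>" "\<delta> N = \<zero>\<^bsub>P\<^esub>"
    and f: "f \<in> S r"
  shows "\<delta> f = \<zero>\<^bsub>P\<^esub>"
proof -
  interpret P: ring P by (rule P)
  note q_simps = ring_hom_closed[OF q] ring_hom_add[OF q, unfolded laurent_C_simps(3)]
    ring_hom_mult[OF q, unfolded laurent_C_simps(2)] ring_hom_one[OF q, unfolded laurent_C_simps(4)]
  note [simp] = q_simps(1) closed S_single
  define y where "y = \<delta> (Poly_Mapping.single (int r) 1)"
  have y [simp]: "y \<in> carrier P" by (simp add: y_def)
  let ?Y = "\<lambda>i. Poly_Mapping.single i (1::'k)"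
  have Y_step: "\<delta> (?Y (i + int r)) = q (?Y i) \<otimes>\<^bsub>P\<^esub> y \<oplus>\<^bsub>P\<^esub> q (?Y (int r)) \<otimes>\<^bsub>P\<^esub> \<delta> (?Y i)"
    if "int r dvd i" for i
    using leibniz[of "?Y i" "?Y (int r)"] that q_central[of "\<delta> (?Y i)"] by (simp add: skew_mult_single y_def)
  have q_Y: "q (?Y i) \<otimes>\<^bsub>P\<^esub> (q (Poly_Mapping.single j c) \<otimes>\<^bsub>P\<^esub> y) = q (Poly_Mapping.single (i + j) c) \<otimes>\<^bsub>P\<^esub> y"
    if "int r dvd i" "int r dvd j" for i j c
    using that q_simps(3)[of "?Y i" "Poly_Mapping.single j c"]
    by (simp add: skew_mult_single pow_dvd P.m_assoc)
  have q_add: "q (Poly_Mapping.single i c) \<otimes>\<^bsub>P\<^esub> y \<oplus>\<^bsub>P\<^esub> q (Poly_Mapping.single i c') \<otimes>\<^bsub>P\<^esub> y =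
      q (Poly_Mapping.single i (c + c')) \<otimes>\<^bsub>P\<^esub> y" if "int r dvd i" for i c c'
    using that by (simp add: single_add q_simps(2) P.l_distr)
  have Y: "\<delta> (?Y i) = q (Poly_Mapping.single (i - int r) (of_int (i div int r))) \<otimes>\<^bsub>P\<^esub> y"
    if "int r dvd i" for i
    using that
  proof (induction i rule: dvd_int_induct)
    case zero
    have "q 0 = \<zero>\<^bsub>P\<^esub>" using ring_hom_zero[OF q ring_S P] by (simp add: laurent_C_simps(5))
    then show ?case using const[of 1] by (simp add: laurent_const_def)
  next
    case (add i)
    then show ?case using r_pos
      by (simp add: Y_step q_Y q_add add.commute)
  next
    \<comment> \<open>Going down, the known value at Y times the smaller power is compared with the
      Leibniz rule, and the invertible element q(Y) is cancelled.\<close>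
    case (diff i)
    let ?w = "q (Poly_Mapping.single (i - int r - int r) (of_int ((i - int r) div int r))) \<otimes>\<^bsub>P\<^esub> y"
    have dvd: "int r dvd i - int r" "int r dvd i - int r - int r" using diff(1) by auto
    have div: "i div int r = (i - int r) div int r + 1" using r_pos div_add_self2[of "int r" "i - int r"] by simp
    have "q (?Y (i - int r)) \<otimes>\<^bsub>P\<^esub> y \<oplus>\<^bsub>P\<^esub> q (?Y (int r)) \<otimes>\<^bsub>P\<^esub> \<delta> (?Y (i - int r)) = \<delta> (?Y i)"
      using Y_step[OF dvd(1)] by simp
    also have "\<dots> = q (?Y (i - int r)) \<otimes>\<^bsub>P\<^esub> y \<oplus>\<^bsub>P\<^esub> q (?Y (int r)) \<otimes>\<^bsub>P\<^esub> ?w"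
      using dvd by (simp add: q_Y q_add diff.IH div add.commute)
    finally have eq: "q (?Y (int r)) \<otimes>\<^bsub>P\<^esub> \<delta> (?Y (i - int r)) = q (?Y (int r)) \<otimes>\<^bsub>P\<^esub> ?w"
      using dvd by (simp add: P.a_comm[of "q (?Y (i - int r)) \<otimes>\<^bsub>P\<^esub> y"])
    have inverse: "q (?Y (- int r)) \<otimes>\<^bsub>P\<^esub> q (?Y (int r)) = \<one>\<^bsub>P\<^esub>"
      using q_simps(3)[of "?Y (- int r)" "?Y (int r)"] q_simps(4) by (simp add: skew_mult_single)
    have cancel: "q (?Y (- int r)) \<otimes>\<^bsub>P\<^esub> (q (?Y (int r)) \<otimes>\<^bsub>P\<^esub> z) = z" if "z \<in> carrier P" for z
      using that by (simp add: inverse flip: P.m_assoc)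
    show ?case
      using arg_cong[OF eq, of "\<lambda>z. q (?Y (- int r)) \<otimes>\<^bsub>P\<^esub> z"] dvd by (simp add: cancel)
  qed
  have \<delta>_eq: "\<delta> f = q (deriv_Y r f) \<otimes>\<^bsub>P\<^esub> y" if "f \<in> S r" for f
  proof -
    have "\<forall>i\<in>Poly_Mapping.keys f. int r dvd i" using that by (simp add: laurent_C_simps(1))
    then show ?thesis
    proof (induction f rule: poly_mapping_single_induct)
      case zero
      have "q 0 = \<zero>\<^bsub>P\<^esub>" using ring_hom_zero[OF q ring_S P] by (simp add: laurent_C_simps(5))
      then show ?case using const[of 0] by (simp add: laurent_const_def deriv_Y_def)
    next
      case (add i c f)
      have f: "f \<in> S r" using add by (simp add: laurent_C_simps(1))
      have "\<delta> (Poly_Mapping.single i c) = q (laurent_const c) \<otimes>\<^bsub>P\<^esub> \<delta> (?Y i)"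
        using leibniz[of "laurent_const c" "?Y i"] add(1) const[of c] laurent_const_closed[of c r]
        by (simp add: laurent_const_def skew_mult_single)
      also have "\<dots> = q (laurent_const c \<star> Poly_Mapping.single (i - int r) (of_int (i div int r))) \<otimes>\<^bsub>P\<^esub> y"
        using add(1) laurent_const_closed[of c r] by (simp add: Y q_simps(3) P.m_assoc)
      also have "\<dots> = q (deriv_Y r (Poly_Mapping.single i c)) \<otimes>\<^bsub>P\<^esub> y"
        by (simp add: laurent_const_def skew_mult_single deriv_Y_single mult.commute)
      finally show ?case
        using add f by (simp add: assms(5) deriv_Y_add q_simps(2) deriv_Y_S P.l_distr)
    qed
  qed
  obtain U V where UV: "U \<in> Z" "V \<in> Z" "U * N + V * deriv_Y r N = 1"
    using separable_bezout[OF N(1,2)] .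
  have mem: "N \<in> S r" "U \<in> S r" "V \<in> S r" "deriv_Y r N \<in> S r"
    using Z_subset[of r] deriv_Y_closed N UV by auto
  have "q (U \<star> N + V \<star> deriv_Y r N) = \<one>\<^bsub>P\<^esub>" using UV q_simps(4) by (simp add: Z_left)
  then have one: "q V \<otimes>\<^bsub>P\<^esub> q (deriv_Y r N) = \<one>\<^bsub>P\<^esub>"
    using mem N(3) by (simp add: q_simps(2,3) S_mult)
  have "y = q V \<otimes>\<^bsub>P\<^esub> (q (deriv_Y r N) \<otimes>\<^bsub>P\<^esub> y)" using mem one by (simp flip: P.m_assoc)
  also have "\<dots> = \<zero>\<^bsub>P\<^esub>" using \<delta>_eq[OF mem(1)] mem by (simp flip: \<delta>_eq[OF mem(1)] add: N(4))
  finally show ?thesis using \<delta>_eq[OF f] f by (simp add: deriv_Y_S)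
qed

text \<open>\<open>P\<close> is general because the lemma is applied with A/NA: the restriction of
  \<tau> to C is not known beforehand to have values in (C/NC)[[T]].\<close>

lemma series_hom_unique:
  assumes P: "ring P" and q: "q \<in> ring_hom (laurent_C \<theta> r) P"
    and q_central: "\<And>z. z \<in> carrier P \<Longrightarrow>
      q (Poly_Mapping.single (int r) 1) \<otimes>\<^bsub>P\<^esub> z = z \<otimes>\<^bsub>P\<^esub> q (Poly_Mapping.single (int r) 1)"
    and s: "s \<in> ring_hom (laurent_C \<theta> r) (power_series_ring P)"
    and s': "s' \<in> ring_hom (laurent_C \<theta> r) (power_series_ring P)"
    and nth_0: "\<And>f. f \<in> S r \<Longrightarrow> s f 0 = q f" "\<And>f. f \<in> S r \<Longrightarrow> s' f 0 = q f"
    and const: "\<And>c. s (laurent_const c) = s' (laurent_const c)"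
    and N: "N \<in> Z" "separable_Z \<theta> r N" "q N = \<zero>\<^bsub>P\<^esub>" "s N = s' N"
    and f: "f \<in> S r"
  shows "s f = s' f"
proof
  interpret P: ring P by (rule P)
  have closed [simp]: "s f n \<in> carrier P" "s' f n \<in> carrier P" if "f \<in> S r" for f n
    using ring_hom_closed[OF s that] ring_hom_closed[OF s' that] by (simp_all add: power_series_ring_simps)
  have add: "s (f + g) n = s f n \<oplus>\<^bsub>P\<^esub> s g n" "s' (f + g) n = s' f n \<oplus>\<^bsub>P\<^esub> s' g n"
    if "f \<in> S r" "g \<in> S r" for f g n
    using ring_hom_add[OF s that] ring_hom_add[OF s' that]
    by (simp_all add: power_series_ring_simps laurent_C_simps(3))
  have mult: "s (f \<star> g) n = (\<Oplus>\<^bsub>P\<^esub>i\<in>{..n}. s f i \<otimes>\<^bsub>P\<^esub> s g (n - i))"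
    "s' (f \<star> g) n = (\<Oplus>\<^bsub>P\<^esub>i\<in>{..n}. s' f i \<otimes>\<^bsub>P\<^esub> s' g (n - i))" if "f \<in> S r" "g \<in> S r" for f g n
    using ring_hom_mult[OF s that] ring_hom_mult[OF s' that]
    by (simp_all add: power_series_ring_simps laurent_C_simps(2))
  have N_mem: "N \<in> S r" using Z_subset[of r] N by auto
  fix n
  show "s f n = s' f n"
    using f
  proof (induction n arbitrary: f rule: less_induct)
    case (less n)
    show ?case
    proof (cases n)
      case 0
      then show ?thesis using nth_0 less.prems by simp
    next
      case (Suc m)
      have "s f n \<ominus>\<^bsub>P\<^esub> s' f n = \<zero>\<^bsub>P\<^esub>"
      proof (rule derivation_eq_0[where q = q and \<delta> = "\<lambda>f. s f n \<ominus>\<^bsub>P\<^esub> s' f n", OF P q q_central])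
        fix f g assume fg: "f \<in> S r" "g \<in> S r"
        show "s f n \<ominus>\<^bsub>P\<^esub> s' f n \<in> carrier P" using fg by simp
        have "(s f n \<oplus>\<^bsub>P\<^esub> s g n) \<ominus>\<^bsub>P\<^esub> (s' f n \<oplus>\<^bsub>P\<^esub> s' g n) =
            (s f n \<ominus>\<^bsub>P\<^esub> s' f n) \<oplus>\<^bsub>P\<^esub> (s g n \<ominus>\<^bsub>P\<^esub> s' g n)"
          using closed[OF fg(1), of n] closed[OF fg(2), of n] by algebra
        then show "s (f + g) n \<ominus>\<^bsub>P\<^esub> s' (f + g) n =
            (s f n \<ominus>\<^bsub>P\<^esub> s' f n) \<oplus>\<^bsub>P\<^esub> (s g n \<ominus>\<^bsub>P\<^esub> s' g n)"
          using fg by (simp add: add)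
        \<comment> \<open>For 0 < i < n both factors have index below n, where s and s' agree by
          induction. Only the two end terms of the convolution survive in the difference, and they
          form the Leibniz rule.\<close>
        let ?M = "\<Oplus>\<^bsub>P\<^esub>i\<in>{1..m}. s f i \<otimes>\<^bsub>P\<^esub> s g (n - i)"
        have M: "(\<Oplus>\<^bsub>P\<^esub>i\<in>{1..m}. s' f i \<otimes>\<^bsub>P\<^esub> s' g (n - i)) = ?M"
          using fg Suc by (intro P.finsum_cong') (auto simp: less.IH)
        have s_eq: "s (f \<star> g) n = q f \<otimes>\<^bsub>P\<^esub> s g n \<oplus>\<^bsub>P\<^esub> ?M \<oplus>\<^bsub>P\<^esub> s f n \<otimes>\<^bsub>P\<^esub> q g"
          using fg P.finsum_split_ends[of "\<lambda>i. s f i \<otimes>\<^bsub>P\<^esub> s g (n - i)" m] by (simp add: mult Suc nth_0)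
        have s'_eq: "s' (f \<star> g) n = q f \<otimes>\<^bsub>P\<^esub> s' g n \<oplus>\<^bsub>P\<^esub> ?M \<oplus>\<^bsub>P\<^esub> s' f n \<otimes>\<^bsub>P\<^esub> q g"
          using fg P.finsum_split_ends[of "\<lambda>i. s' f i \<otimes>\<^bsub>P\<^esub> s' g (n - i)" m] M by (simp add: mult Suc nth_0)
        show "s (f \<star> g) n \<ominus>\<^bsub>P\<^esub> s' (f \<star> g) n =
            q f \<otimes>\<^bsub>P\<^esub> (s g n \<ominus>\<^bsub>P\<^esub> s' g n) \<oplus>\<^bsub>P\<^esub> (s f n \<ominus>\<^bsub>P\<^esub> s' f n) \<otimes>\<^bsub>P\<^esub> q g"
          unfolding s_eq s'_eq using fg ring_hom_closed[OF q] P.finsum_closed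
          by (intro P.leibniz_difference) auto
      next
        show "s (laurent_const c) n \<ominus>\<^bsub>P\<^esub> s' (laurent_const c) n = \<zero>\<^bsub>P\<^esub>" for c
          using laurent_const_closed[of c r] closed(2)[of "laurent_const c" n]
          by (simp add: const a_minus_def P.r_neg)
        show "s N n \<ominus>\<^bsub>P\<^esub> s' N n = \<zero>\<^bsub>P\<^esub>"
          using closed(2)[OF N_mem, of n] by (simp add: N a_minus_def P.r_neg)
      qed (use N less.prems in auto)
      then show ?thesis
        using less.prems P.minus_equality[of "s f n" "\<ominus>\<^bsub>P\<^esub> s' f n"] by (simp add: a_minus_def)
    qed
  qed
qed


subsection \<open>The inclusion of the commutative subring\<close>

lemma nat_pow_C_eq: "N [^]\<^bsub>laurent_C \<theta> d\<^esub> (m::nat) = N [^]\<^bsub>laurent_C \<theta> e\<^esub> m"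
  by (induction m) (simp_all add: laurent_C_simps)

lemma multiples_mono: "d dvd r \<Longrightarrow> multiples (laurent_C \<theta> r) z \<subseteq> multiples (laurent_C \<theta> d) z"
  using S_mono[of d] by (auto simp: multiples_def laurent_C_simps(2))

lemma coset_incl:
  assumes d: "d dvd r" and z: "z \<in> Z" and c: "c \<in> S r"
  shows "multiples (laurent_C \<theta> d) z <+>\<^bsub>laurent_C \<theta> d\<^esub> (multiples (laurent_C \<theta> r) z +>\<^bsub>laurent_C \<theta> r\<^esub> c)
    = multiples (laurent_C \<theta> d) z +>\<^bsub>laurent_C \<theta> d\<^esub> c"
proof -
  interpret A: central_element "laurent_C \<theta> d" z by (rule central[OF d z])
  interpret C: central_element "laurent_C \<theta> r" z by (rule central[OF dvd_refl z])
  have "a + b \<in> multiples (laurent_C \<theta> d) z"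
    if "a \<in> multiples (laurent_C \<theta> d) z" "b \<in> multiples (laurent_C \<theta> r) z" for a b
    using A.one.a_closed[of a b] multiples_mono[OF d, of z] that by (auto simp: laurent_C_simps(3))
  moreover have "0 \<in> multiples (laurent_C \<theta> r) z"
    using C.one.zero_closed by (simp add: laurent_C_simps(5))
  ultimately show ?thesis
    unfolding set_add_def' a_r_coset_def' laurent_C_simps(3)
    by (auto simp flip: add.assoc)
qed

lemma nat_pow_Z: "z \<in> Z \<Longrightarrow> z [^]\<^bsub>laurent_C \<theta> d\<^esub> (m::nat) \<in> Z"
  by (induction m) (simp_all add: laurent_C_simps Z_1 Z_mult Z_left)

lemma inclusion_hom: "d dvd r \<Longrightarrow> (\<lambda>f. f) \<in> ring_hom (laurent_C \<theta> r) (laurent_C \<theta> d)"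
  using S_mono[of d] by (intro ring_hom_memI) (auto simp: laurent_C_simps(2-))

text \<open>
  Multiplication by \<open>z\<close> respects exponents modulo \<open>r\<close>, so the cofactor can be projected to
  \<open>K[Y\<^sup>\<plusminus>\<^sup>1]\<close>.
\<close>

lemma multiples_inter:
  assumes "z \<in> Z" "c \<in> S r" "c \<in> multiples (laurent_C \<theta> d) z"
  shows "c \<in> multiples (laurent_C \<theta> r) z"
proof -
  define \<pi> where "\<pi> f = Poly_Mapping.mapp (\<lambda>i c. c when int r dvd i) f" for f :: "int \<Rightarrow>\<^sub>0 'k"
  have lookup_\<pi>: "Poly_Mapping.lookup (\<pi> f) i = (Poly_Mapping.lookup f i when int r dvd i)" for f i
    by (auto simp: \<pi>_def lookup_mapp when_def in_keys_iff)
  have \<pi>_add: "\<pi> (f + g) = \<pi> f + \<pi> g" for f g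
    by (intro poly_mapping_eqI) (simp add: lookup_\<pi> lookup_add when_def)
  have \<pi>_single: "\<pi> (Poly_Mapping.single i a) = (if int r dvd i then Poly_Mapping.single i a else 0)" for i a
    by (intro poly_mapping_eqI) (auto simp: lookup_\<pi> lookup_single when_def)
  have \<pi>_0: "\<pi> 0 = 0" by (intro poly_mapping_eqI) (simp add: lookup_\<pi>)
  have \<pi>_mult: "\<pi> (h \<star> f) = h \<star> \<pi> f" if "\<forall>i\<in>Poly_Mapping.keys h. int r dvd i" for h f
    using that
  proof (induction h rule: poly_mapping_single_induct)
    case (add i a h)
    have "\<pi> (Poly_Mapping.single i a \<star> f) = Poly_Mapping.single i a \<star> \<pi> f"
      using add(1) by (induction f rule: any_single_induct)
        (simp_all add: \<pi>_add \<pi>_single \<pi>_0 skew_mult_add_right skew_mult_single dvd_add_right_iff)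
    then show ?case using add by (simp add: \<pi>_add skew_mult_add_left)
  qed (simp add: \<pi>_0)
  obtain a where a: "c = z \<star> a"
    using assms(3) by (auto simp: multiples_def laurent_C_simps(2))
  have "\<pi> c = c" using assms(2) by (intro poly_mapping_eqI) (auto simp: lookup_\<pi> S_iff when_def)
  then have "c = z \<star> \<pi> a" using \<pi>_mult[of z a] assms(1) by (simp add: a Z_iff laurent_C_simps(1))
  moreover have "\<pi> a \<in> S r" by (auto simp: S_iff lookup_\<pi> when_def split: if_splits)
  ultimately show ?thesis by (auto simp: multiples_def laurent_C_simps(2))
qed

section \<open>Comparison of the completions and quotients of C and A\<close>

context
  fixes N and d :: nat
  assumes N: "N \<in> Z" and sep: "separable_Z \<theta> r N" and d: "d dvd r"
begin

abbreviation A where "A \<equiv> laurent_C \<theta> d"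
abbreviation C where "C \<equiv> laurent_C \<theta> r"

interpretation A: central_element A N by (rule central[OF d N])
interpretation C: central_element C N by (rule central[OF dvd_refl N])

lemma S_A: "f \<in> S r \<Longrightarrow> f \<in> S d"
  using S_mono[OF d] by blast

lemma proj_incl:
  "c \<in> S r \<Longrightarrow> multiples A (N [^]\<^bsub>A\<^esub> (m::nat)) <+>\<^bsub>A\<^esub> C.proj m c = A.proj m c"
  using coset_incl[OF d nat_pow_Z[OF N, of r m]] nat_pow_C_eq[where N = N and d = r and e = d and m = m]
  by simp

lemma proj_incl_1:
  "c \<in> S r \<Longrightarrow> multiples A N <+>\<^bsub>A\<^esub> (multiples C N +>\<^bsub>C\<^esub> c) = multiples A N +>\<^bsub>A\<^esub> c"
  by (rule coset_incl[OF d N])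

lemma completion_incl_eval:
  "1 \<le> m \<Longrightarrow> x m = C.proj m c \<Longrightarrow> c \<in> S r \<Longrightarrow> completion_incl A N x m = A.proj m c"
  by (simp add: completion_incl_def proj_incl)

lemma completion_incl_closed:
  assumes "x \<in> carrier (adic_completion C N)"
  shows "completion_incl A N x \<in> carrier (adic_completion A N)"
  unfolding A.adic_carrier_iff
proof (intro conjI allI impI)
  show "completion_incl A N x \<in> extensional {1..}" by (simp add: completion_incl_def)
  fix m :: nat assume "1 \<le> m"
  obtain c where c: "c \<in> S r" "\<And>k. 1 \<le> k \<Longrightarrow> k \<le> m \<Longrightarrow> x k = C.proj k c"
    using C.adic_repr[OF assms] by blast
  show "\<exists>a\<in>S d. \<forall>k\<in>{1..m}. completion_incl A N x k = A.proj k a"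
    using c by (intro bexI[of _ c] ballI completion_incl_eval) (auto simp: S_A)
qed

lemma completion_incl_to_completion:
  "c \<in> S r \<Longrightarrow> completion_incl A N (to_completion C N c) = to_completion A N c"
  unfolding completion_incl_def to_completion_def by (intro restrict_ext) (simp add: proj_incl)

lemma completion_incl_hom:
  "completion_incl A N \<in> ring_hom (adic_completion C N) (adic_completion A N)"
proof (rule ring_hom_memI)
  fix x y assume x: "x \<in> carrier (adic_completion C N)" and y: "y \<in> carrier (adic_completion C N)"
  note closed = completion_incl_closed[OF x] completion_incl_closed[OF y]
  have repr: "\<exists>a b. a \<in> S r \<and> b \<in> S r \<and> x m = C.proj m a \<and> y m = C.proj m b" if "1 \<le> m" for m
    using C.adic_repr[OF x, of m] C.adic_repr[OF y, of m] that by (metis order_refl)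
  show "completion_incl A N (x \<otimes>\<^bsub>adic_completion C N\<^esub> y) =
      completion_incl A N x \<otimes>\<^bsub>adic_completion A N\<^esub> completion_incl A N y"
  proof (rule A.adic_eqI)
    fix m :: nat assume m: "1 \<le> m"
    obtain a b where ab: "a \<in> S r" "b \<in> S r" "x m = C.proj m a" "y m = C.proj m b"
      using repr[OF m] by blast
    have "completion_incl A N (x \<otimes>\<^bsub>adic_completion C N\<^esub> y) m = A.proj m (a \<otimes>\<^bsub>C\<^esub> b)"
      using m ab by (intro completion_incl_eval C.adic_mult_eval) auto
    also have "\<dots> = (completion_incl A N x \<otimes>\<^bsub>adic_completion A N\<^esub> completion_incl A N y) m"
      using A.adic_mult_eval[where x = "completion_incl A N x" and y = "completion_incl A N y", OF m
        completion_incl_eval[where x = x, OF m ab(3,1)]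
        completion_incl_eval[where x = y, OF m ab(4,2)]] ab
      by (simp add: S_A laurent_C_simps(2))
    finally show "completion_incl A N (x \<otimes>\<^bsub>adic_completion C N\<^esub> y) m =
      (completion_incl A N x \<otimes>\<^bsub>adic_completion A N\<^esub> completion_incl A N y) m" .
  qed (use x y in \<open>auto intro: completion_incl_closed A.adic_mult_closed C.adic_mult_closed\<close>)
  show "completion_incl A N (x \<oplus>\<^bsub>adic_completion C N\<^esub> y) =
      completion_incl A N x \<oplus>\<^bsub>adic_completion A N\<^esub> completion_incl A N y"
  proof (rule A.adic_eqI)
    fix m :: nat assume m: "1 \<le> m"
    obtain a b where ab: "a \<in> S r" "b \<in> S r" "x m = C.proj m a" "y m = C.proj m b"
      using repr[OF m] by blast
    have "completion_incl A N (x \<oplus>\<^bsub>adic_completion C N\<^esub> y) m = A.proj m (a \<oplus>\<^bsub>C\<^esub> b)"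
      using m ab by (intro completion_incl_eval C.adic_add_eval) auto
    also have "\<dots> = (completion_incl A N x \<oplus>\<^bsub>adic_completion A N\<^esub> completion_incl A N y) m"
      using A.adic_add_eval[where x = "completion_incl A N x" and y = "completion_incl A N y", OF m
        completion_incl_eval[where x = x, OF m ab(3,1)]
        completion_incl_eval[where x = y, OF m ab(4,2)]] ab
      by (simp add: S_A laurent_C_simps(3))
    finally show "completion_incl A N (x \<oplus>\<^bsub>adic_completion C N\<^esub> y) m =
      (completion_incl A N x \<oplus>\<^bsub>adic_completion A N\<^esub> completion_incl A N y) m" .
  qed (use x y in \<open>auto intro: completion_incl_closed A.adic_add_closed C.adic_add_closed\<close>)
next
  show "completion_incl A N \<one>\<^bsub>adic_completion C N\<^esub> = \<one>\<^bsub>adic_completion A N\<^esub>"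
    using ring_hom_one[OF A.to_completion_hom] ring_hom_one[OF C.to_completion_hom]
      completion_incl_to_completion[OF S_1]
    by (simp add: laurent_C_simps(4))
qed (rule completion_incl_closed)

abbreviation incl_quot :: "(int \<Rightarrow>\<^sub>0 'k) set \<Rightarrow> (int \<Rightarrow>\<^sub>0 'k) set" where
  "incl_quot B \<equiv> multiples A N <+>\<^bsub>A\<^esub> B"

lemma incl_quot_hom: "incl_quot \<in> ring_hom C.Q A.Q"
proof (rule ring_hom_memI)
  fix B B' assume "B \<in> carrier C.Q" "B' \<in> carrier C.Q"
  then obtain c c' where c: "c \<in> S r" "c' \<in> S r" "B = multiples C N +>\<^bsub>C\<^esub> c" "B' = multiples C N +>\<^bsub>C\<^esub> c'"
    by (auto simp: C.one.carrier_quot)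
  show "incl_quot B \<in> carrier A.Q" using c by (simp add: proj_incl_1 A.one.carrier_quot S_A)
  show "incl_quot (B \<otimes>\<^bsub>C.Q\<^esub> B') = incl_quot B \<otimes>\<^bsub>A.Q\<^esub> incl_quot B'"
    using c C.m_closed[OF c(1,2)]
    by (simp add: proj_incl_1 C.Q_simps A.Q_simps S_A) (simp add: laurent_C_simps(2))
  show "incl_quot (B \<oplus>\<^bsub>C.Q\<^esub> B') = incl_quot B \<oplus>\<^bsub>A.Q\<^esub> incl_quot B'"
    using c C.a_closed[OF c(1,2)]
    by (simp add: proj_incl_1 C.Q_simps A.Q_simps S_A) (simp add: laurent_C_simps(3))
next
  have one: "\<one>\<^bsub>C.Q\<^esub> = multiples C N +>\<^bsub>C\<^esub> 1" "\<one>\<^bsub>A.Q\<^esub> = multiples A N +>\<^bsub>A\<^esub> 1"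
    by (simp_all add: FactRing_def laurent_C_simps(4))
  show "incl_quot \<one>\<^bsub>C.Q\<^esub> = \<one>\<^bsub>A.Q\<^esub>" unfolding one by (rule proj_incl_1[OF S_1])
qed

text \<open>Injectivity of C/NC into A/NA, that is, NA meets C in NC. It allows identities proved in
  (A/NA)[[T]] to be pulled back to (C/NC)[[T]].\<close>

lemma incl_quot_inj:
  assumes "B \<in> carrier C.Q" "B' \<in> carrier C.Q" "incl_quot B = incl_quot B'"
  shows "B = B'"
proof -
  obtain c c' where c: "c \<in> S r" "c' \<in> S r" "B = multiples C N +>\<^bsub>C\<^esub> c" "B' = multiples C N +>\<^bsub>C\<^esub> c'"
    using assms by (auto simp: C.one.carrier_quot)
  have minus: "a \<ominus>\<^bsub>laurent_C \<theta> d\<^esub> b = a - b" if "a \<in> S d" "b \<in> S d" for a b d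
  proof -
    interpret R: ring "laurent_C \<theta> d" by (rule ring_S)
    have "\<ominus>\<^bsub>laurent_C \<theta> d\<^esub> b = - b"
      using that S_uminus[OF that(2)] by (intro R.minus_equality) (simp_all add: laurent_C_simps(3,5))
    then show ?thesis by (simp add: a_minus_def laurent_C_simps(3))
  qed
  have "c - c' \<in> multiples A N"
    using assms(3) c A.one.quot_eq_iff[of c c'] by (simp add: proj_incl_1 minus S_A)
  moreover have "c - c' \<in> S r" using C.minus_closed[OF c(1,2)] c by (simp add: minus)
  ultimately have "c - c' \<in> multiples C N" by (intro multiples_inter[OF N])
  then show ?thesis using c C.one.quot_eq_iff[of c c'] by (simp add: minus)
qed

text \<open>Both sides come from homomorphisms of the completion of C to (A/NA)[[T]]. On C they
  agree by \<open>series_hom_unique\<close>, with common residue map \<open>q\<close> from C through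
  A to A/NA; \<open>adic_hom_unique\<close> passes to the completion, with \<sigma> used to split
  off multiples of N.\<close>

lemma tau_compatible:
  assumes \<tau>: "is_tau A N \<tau>" and \<sigma>: "is_tau C N \<sigma>" and x: "x \<in> carrier (adic_completion C N)"
  shows "\<tau> (completion_incl A N x) = series_incl A N (\<sigma> x)"
proof -
  have \<tau>_hom: "\<tau> \<in> ring_hom (adic_completion A N) (power_series_ring A.Q)"
    and \<tau>_const: "\<And>a. \<tau> (to_completion A N (laurent_const a)) =
      series_const A.Q (multiples A N +>\<^bsub>A\<^esub> laurent_const a)"
    and \<tau>_N: "\<tau> (to_completion A N N) = series_T A.Q"
    and \<tau>_0: "\<And>x. x \<in> carrier (adic_completion A N) \<Longrightarrow> \<tau> x 0 = x 1"
    using \<tau> by (auto simp: is_tau_def alg_iso_def ring_iso_def quot_series_def)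
  have \<sigma>_iso: "\<sigma> \<in> ring_iso (adic_completion C N) (quot_series C N)"
    and \<sigma>_hom: "\<sigma> \<in> ring_hom (adic_completion C N) (power_series_ring C.Q)"
    and \<sigma>_const: "\<And>a. \<sigma> (to_completion C N (laurent_const a)) =
      series_const C.Q (multiples C N +>\<^bsub>C\<^esub> laurent_const a)"
    and \<sigma>_N: "\<sigma> (to_completion C N N) = series_T C.Q"
    and \<sigma>_0: "\<forall>x\<in>carrier (adic_completion C N). \<sigma> x 0 = x 1"
    using \<sigma> by (auto simp: is_tau_def alg_iso_def ring_iso_def quot_series_def)
  have incl_0: "incl_quot \<zero>\<^bsub>C.Q\<^esub> = \<zero>\<^bsub>A.Q\<^esub>"
    by (rule ring_hom_zero[OF incl_quot_hom C.Q.ring_axioms A.Q.ring_axioms])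
  have incl_1: "incl_quot \<one>\<^bsub>C.Q\<^esub> = \<one>\<^bsub>A.Q\<^esub>" by (rule ring_hom_one[OF incl_quot_hom])
  have incl_T: "series_incl A N (series_T C.Q) = series_T A.Q"
    by (auto simp: fun_eq_iff series_incl_def series_T_def incl_0 incl_1)
  have incl_hom: "series_incl A N \<in> ring_hom (power_series_ring C.Q) (power_series_ring A.Q)"
    using power_series_ring_hom[OF incl_quot_hom C.Q.ring_axioms A.Q.ring_axioms]
    by (simp add: series_incl_def[abs_def])
  define s where "s = \<tau> \<circ> completion_incl A N"
  define s' where "s' = series_incl A N \<circ> \<sigma>"
  have s: "s \<in> ring_hom (adic_completion C N) (power_series_ring A.Q)"
    unfolding s_def by (rule ring_hom_trans[OF completion_incl_hom \<tau>_hom])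
  have s': "s' \<in> ring_hom (adic_completion C N) (power_series_ring A.Q)"
    unfolding s'_def by (rule ring_hom_trans[OF \<sigma>_hom incl_hom])
  define q where "q = (+>\<^bsub>A\<^esub>) (multiples A N) \<circ> (\<lambda>f. f)"
  have q: "q \<in> ring_hom C A.Q"
    unfolding q_def by (rule ring_hom_trans[OF inclusion_hom[OF d] A.one.rcos_ring_hom])
  have N_C: "N \<in> S r" using N by (simp add: Z_iff)
  have s_N: "s (to_completion C N N) = series_T A.Q" "s' (to_completion C N N) = series_T A.Q"
    by (simp_all add: s_def s'_def completion_incl_to_completion[OF N_C] \<tau>_N \<sigma>_N incl_T)
  have "s (to_completion C N c) = s' (to_completion C N c)" if c: "c \<in> S r" for c
  proof -
    have "(s \<circ> to_completion C N) c = (s' \<circ> to_completion C N) c"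
    proof (rule series_hom_unique[OF A.Q.ring_axioms q, where N = N])
      show "s \<circ> to_completion C N \<in> ring_hom C (power_series_ring A.Q)"
        "s' \<circ> to_completion C N \<in> ring_hom C (power_series_ring A.Q)"
        using ring_hom_trans[OF C.to_completion_hom] s s' by blast+
      show "q (Poly_Mapping.single (int r) 1) \<otimes>\<^bsub>A.Q\<^esub> z = z \<otimes>\<^bsub>A.Q\<^esub> q (Poly_Mapping.single (int r) 1)"
        if z: "z \<in> carrier A.Q" for z
      proof -
        obtain f where f: "f \<in> S d" "z = multiples A N +>\<^bsub>A\<^esub> f" using z by (auto simp: A.one.carrier_quot)
        have "Poly_Mapping.single (int r) 1 \<in> Z" by (intro Z_single) (simp_all add: \<theta>_1)
        moreover have "Poly_Mapping.single (int r) 1 \<in> S d" using d by (intro S_single) simp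
        ultimately show ?thesis by (simp add: f q_def A.Q_simps S_A)
          (simp add: laurent_C_simps(2) Z_left Z_right)
      qed
      show "(s \<circ> to_completion C N) f 0 = q f" if "f \<in> S r" for f
        using that by (simp add: s_def q_def completion_incl_to_completion \<tau>_0 A.to_completion_closed S_A)
          (simp add: to_completion_def A.N_carrier)
      show "(s' \<circ> to_completion C N) f 0 = q f" if "f \<in> S r" for f
        using that \<sigma>_0 C.to_completion_closed[OF that]
        by (simp add: s'_def q_def series_incl_def to_completion_def C.N_carrier proj_incl_1)
      show "(s \<circ> to_completion C N) (laurent_const c) = (s' \<circ> to_completion C N) (laurent_const c)" for c
        using laurent_const_closed[of c r]
        by (simp add: s_def s'_def completion_incl_to_completion \<tau>_const \<sigma>_const fun_eq_iff
            series_incl_def series_const_def proj_incl_1 incl_0)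
      show "q N = \<zero>\<^bsub>A.Q\<^esub>"
        using A.a_rcos_zero[OF A.one.is_ideal multiplesI[of 1 A N N]] S_1[of d]
        by (simp add: q_def FactRing_def laurent_C_simps(2))
      show "(s \<circ> to_completion C N) N = (s' \<circ> to_completion C N) N" by (simp add: s_N)
    qed (use N sep c in auto)
    then show ?thesis by simp
  qed
  then have "s x = s' x"
    by (intro C.adic_hom_unique[OF A.Q.ring_axioms s s' s_N _ \<sigma>_iso \<sigma>_N \<sigma>_0 x])
  then show ?thesis by (simp add: s_def s'_def)
qed

lemma is_tau_restrict:
  assumes "is_tau C N \<sigma>"
  shows "is_tau C N (restrict \<sigma> (carrier (adic_completion C N)))"
proof -
  let ?\<sigma> = "restrict \<sigma> (carrier (adic_completion C N))"
  have hom: "\<sigma> \<in> ring_hom (adic_completion C N) (quot_series C N)"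
    and bij: "bij_betw \<sigma> (carrier (adic_completion C N)) (carrier (quot_series C N))"
    using assms by (auto simp: is_tau_def alg_iso_def ring_iso_def)
  have "?\<sigma> \<in> ring_hom (adic_completion C N) (quot_series C N)"
    using ring_hom_memE[OF hom] C.adic_mult_closed C.adic_add_closed C.adic_one_closed
    by (intro ring_hom_memI) auto
  moreover have "bij_betw ?\<sigma> (carrier (adic_completion C N)) (carrier (quot_series C N))"
    using bij by (simp cong: bij_betw_cong)
  ultimately show ?thesis
    using assms C.to_completion_closed laurent_const_closed[of _ r] C.N_carrier
    by (simp add: is_tau_def alg_iso_def ring_iso_def)
qed

text \<open>Uniqueness on C is read off from compatibility: two candidates \<sigma> and \<sigma>'
  both become the restriction of one and the same \<tau> after inclusion into (A/NA)[[T]], and this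
  inclusion is injective coefficient by coefficient.\<close>

lemma tau_C_eq:
  assumes \<sigma>: "is_tau C N \<sigma>"
  shows "tau_C \<theta> r N = restrict \<sigma> (carrier (adic_completion C N))"
  unfolding tau_C_def
proof (rule the_equality)
  obtain \<tau> where \<tau>: "is_tau A N \<tau>" using exists_tau[OF d N sep] by blast
  show "restrict \<sigma> (carrier (adic_completion C N)) \<in> extensional (carrier (adic_completion C N)) \<and>
      is_tau C N (restrict \<sigma> (carrier (adic_completion C N)))"
    using is_tau_restrict[OF \<sigma>] by simp
  fix \<sigma>' assume \<sigma>': "\<sigma>' \<in> extensional (carrier (adic_completion C N)) \<and> is_tau C N \<sigma>'"
  have closed: "\<rho> x n \<in> carrier C.Q" if "is_tau C N \<rho>" "x \<in> carrier (adic_completion C N)" for \<rho> x n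
    using that ring_hom_closed[of \<rho> "adic_completion C N" "quot_series C N" x]
    by (simp add: is_tau_def alg_iso_def ring_iso_def quot_series_def power_series_ring_simps)
  show "\<sigma>' = restrict \<sigma> (carrier (adic_completion C N))"
  proof (rule extensionalityI)
    fix x assume x: "x \<in> carrier (adic_completion C N)"
    have "series_incl A N (\<sigma>' x) = series_incl A N (\<sigma> x)"
      by (rule trans[OF sym[OF tau_compatible[OF \<tau> conjunct2[OF \<sigma>'] x]] tau_compatible[OF \<tau> \<sigma> x]])
    then have eq: "incl_quot (\<sigma>' x n) = incl_quot (\<sigma> x n)" for n
      by (simp add: series_incl_def fun_eq_iff)
    have "\<sigma>' x n = \<sigma> x n" for n 
      by (rule incl_quot_inj[OF closed[OF conjunct2[OF \<sigma>'] x] closed[OF \<sigma> x] eq])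
    then show "\<sigma>' x = restrict \<sigma> (carrier (adic_completion C N)) x" using x by auto
  qed (use \<sigma>' in auto)
qed

end

end

theorem theorem2p2p1:
  fixes \<theta> :: "'k::field \<Rightarrow> 'k" and r :: nat and N :: "int \<Rightarrow>\<^sub>0 'k"
  assumes "field_automorphism \<theta>"
    and "has_order \<theta> r"
    and "N \<in> carrier (laurent_Z \<theta> r)"
    and "separable_Z \<theta> r N"
  shows "(\<exists>\<tau>. is_tau (skew_laurent \<theta>) N \<tau>) \<and>
    (\<forall>\<tau>. is_tau (skew_laurent \<theta>) N \<tau> \<longrightarrow>
      (\<forall>x\<in>carrier (adic_completion (laurent_C \<theta> r) N).
         \<tau> (completion_incl (skew_laurent \<theta>) N x)
           \<in> series_incl (skew_laurent \<theta>) N ` carrier (quot_series (laurent_C \<theta> r) N) \<and>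
         \<tau> (completion_incl (skew_laurent \<theta>) N x)
           = series_incl (skew_laurent \<theta>) N (tau_C \<theta> r N x)))"
proof (intro conjI allI impI ballI)
  interpret finite_order_automorphism \<theta> r using assms by unfold_locales
  show "\<exists>\<tau>. is_tau (skew_laurent \<theta>) N \<tau>"
    unfolding skew_laurent_eq using assms by (intro exists_tau) auto
  fix \<tau> x assume \<tau>: "is_tau (skew_laurent \<theta>) N \<tau>" and x: "x \<in> carrier (adic_completion (laurent_C \<theta> r) N)"
  \<comment> \<open>The case d = r of existence provides a witness for the description defining
    \<open>tau_C\<close>, which then equals \<sigma> on the completion.\<close>
  obtain \<sigma> where \<sigma>: "is_tau (laurent_C \<theta> r) N \<sigma>"
    using exists_tau[OF dvd_refl assms(3,4)] by blast
  show eq: "\<tau> (completion_incl (skew_laurent \<theta>) N x) = series_incl (skew_laurent \<theta>) N (tau_C \<theta> r N x)"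
    using tau_compatible[OF assms(3,4) one_dvd \<tau>[unfolded skew_laurent_eq] \<sigma> x] x
    by (simp only: skew_laurent_eq tau_C_eq[OF assms(3,4) one_dvd \<sigma>] restrict_apply')
  have "\<sigma> x \<in> carrier (quot_series (laurent_C \<theta> r) N)"
    using ring_hom_closed[OF _ x] \<sigma> by (auto simp: is_tau_def alg_iso_def ring_iso_def)
  then show "\<tau> (completion_incl (skew_laurent \<theta>) N x)
      \<in> series_incl (skew_laurent \<theta>) N ` carrier (quot_series (laurent_C \<theta> r) N)"
    using x by (simp add: eq tau_C_eq[OF assms(3,4) one_dvd \<sigma>])
qed

end
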